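(* Assume that the linear system $\dot x=L(t)x$ is exponentially stable. Then the nonautonomous set $\mathcal{A}=(A_t)_{t\in\mathbb{R}}$ defined by $$A_t=\Big\{x\in\mathbb{R}^d : x=\rho\int_{-\infty}^t\Psi(t,s)\xi(s)\,ds\ \text{ for some }\xi\in\mathcal{U}\Big\}$$ is uniformly bounded, and it is the unique minimal invariant set for the two-parameter set-valued semigroup $\Phi$ induced by the differential inclusion $\dot x\in\overline{B_\rho}(L(t)x)$. Moreover, for every nonempty compact set $K\subset\mathbb{R}^d$, $$\lim_{t_0\to-\infty}\mathrm{dist}(\Phi^{t,t_0}(K),A_t)=0\quad\text{for all }t\in\mathbb{R},$$ and $$\lim_{t\to\infty}\mathrm{dist}(\Phi^{t,t_0}(K),A_t)=0\quad\text{for all }t_0\in\mathbb{R},$$ that is, $\mathcal{A}$ pullback and forward attracts every compact subset of $\mathbb{R}^d$.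
   Context: Let $d\ge2$, $\rho>0$, $L:\mathbb{R}\to\mathbb{R}^{d\times d}$ locally integrable, and $\mathcal{U}=\{\xi\in L^\infty(\mathbb{R},\mathbb{R}^d):\|\xi\|_\infty\le1\}$. $\overline{B_\rho}(y)$ is the closed ball of radius $\rho$ centred at $y$. $\Psi(t,s)$ is the principal matrix solution of $\dot x=L(t)x$ at $s$ (i.e. $\Psi(s,s)=I$). Exponential stability means: there are constants $\kappa\ge1$, $\gamma>0$ with $\|\Psi(t,s)\|\le \kappa e^{-\gamma(t-s)}$ for all $t\ge s$. For $x_0\in\mathbb{R}^d$ and $t>t_0$, $\Phi^{t,t_0}(x_0)$ is the set of values at time $t$ of all (Carathéodory) solutions of $\dot x=L(t)x+\rho\xi(t)$, $x(t_0)=x_0$, with $\xi\in\mathcal{U}$; for a set $M$, $\Phi^{t,t_0}(M)=\bigcup_{x\in M}\Phi^{t,t_0}(x)$. Here $\mathrm{dist}(M_1,M_2)=\sup_{x\in M_1}\inf_{y\in M_2}|x-y|$. A nonautonomous set is a family $\mathscr{M}=(M_t)_{t\in\mathbb{R}}$ of subsets of $\mathbb{R}^d$; it is uniformly bounded if all $M_t$ lie in one common ball. An invariant set is a nonautonomous set with nonempty compact fibres such that $\Phi^{t,t_0}(M_{t_0})=M_t$ for all $t>t_0$. It is minimal invariant if it contains no proper nonempty (fibre-wise) closed nonautonomous subset which is invariant.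
   Formalization: Uniqueness of the minimal invariant set is proved among uniformly bounded nonautonomous sets only; without boundedness it fails, since for every v ≠ 0 the translate A_t + Ψ(t,0)v is another minimal invariant set. *)

theory Defs
  imports "HOL-Analysis.Analysis" "HOL-Probability.Essential_Supremum"
begin

text \<open>
  The classical epsilon-delta notion (finitely many non-overlapping intervals of small total
  length), not the absolute continuity of measures in the library. The members of a division
  are nonempty compact intervals, so \<open>Inf k\<close> and \<open>Sup k\<close> are the endpoints of \<open>k\<close>.
\<close>

definition absolutely_continuous_on :: "real set \<Rightarrow> (real \<Rightarrow> 'a::real_normed_vector) \<Rightarrow> bool" where
  "absolutely_continuous_on S f \<longleftrightarrow>
     (\<forall>\<epsilon>>0. \<exists>\<delta>>0. \<forall>D T. D division_of T \<and> T \<subseteq> S \<and> (\<Sum>k\<in>D. Sup k - Inf k) < \<delta> \<longrightarrow>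
        (\<Sum>k\<in>D. norm (f (Sup k) - f (Inf k))) < \<epsilon>)"

text \<open>Solutions of \<open>x' = f(t, x)\<close> on the interval \<open>I\<close>; values of \<open>x\<close> outside \<open>I\<close> are irrelevant.\<close>

definition caratheodory_solution ::
    "real set \<Rightarrow> (real \<Rightarrow> 'a::real_normed_vector \<Rightarrow> 'a) \<Rightarrow> (real \<Rightarrow> 'a) \<Rightarrow> bool" where
  "caratheodory_solution I f x \<longleftrightarrow>
     (\<forall>a b. {a..b} \<subseteq> I \<longrightarrow> absolutely_continuous_on {a..b} x) \<and>
     (AE t in lebesgue. t \<in> I \<longrightarrow> (x has_vector_derivative f t (x t)) (at t within I))"

definition locally_integrable :: "(real \<Rightarrow> 'a::euclidean_space) \<Rightarrow> bool" where
  "locally_integrable f \<longleftrightarrow> (\<forall>a b. f absolutely_integrable_on {a..b})"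

definition principal_matrix_solution ::
    "(real \<Rightarrow> real^'n^'n) \<Rightarrow> (real \<Rightarrow> real \<Rightarrow> real^'n^'n) \<Rightarrow> bool" where
  "principal_matrix_solution L \<Psi> \<longleftrightarrow>
     (\<forall>s. caratheodory_solution UNIV (\<lambda>t X. L t ** X) (\<lambda>t. \<Psi> t s) \<and> \<Psi> s s = mat 1)"

definition exponentially_stable :: "(real \<Rightarrow> real \<Rightarrow> real^'n^'n) \<Rightarrow> bool" where
  "exponentially_stable \<Psi> \<longleftrightarrow>
     (\<exists>\<kappa>\<ge>1. \<exists>\<gamma>>0. \<forall>t s. s \<le> t \<longrightarrow> onorm ((*v) (\<Psi> t s)) \<le> \<kappa> * exp (- \<gamma> * (t - s)))"

text \<open>The unit ball of \<open>L\<^sup>\<infinity>(\<real>, \<real>\<^sup>d)\<close>, with representatives in place of classes modulo null sets.\<close>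

definition controls :: "(real \<Rightarrow> real^'n) set" where
  "controls = {\<xi> \<in> borel_measurable lebesgue. esssup lebesgue (\<lambda>t. ereal (norm (\<xi> t))) \<le> 1}"

text \<open>
  \<open>flow L \<rho> t t\<^sub>0 x\<^sub>0\<close> and \<open>flow_set L \<rho> t t\<^sub>0 M\<close> are the point and set versions of
  \<open>\<Phi>\<close> from time \<open>t\<^sub>0\<close> to time \<open>t\<close>. They are meaningful for \<open>t\<^sub>0 < t\<close> only.
\<close>

definition flow ::
    "(real \<Rightarrow> real^'n^'n) \<Rightarrow> real \<Rightarrow> real \<Rightarrow> real \<Rightarrow> real^'n \<Rightarrow> (real^'n) set" where
  "flow L \<rho> t t\<^sub>0 x\<^sub>0 =
     {x t | x \<xi>. \<xi> \<in> controls \<and>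
        caratheodory_solution {t\<^sub>0..t} (\<lambda>s y. L s *v y + \<rho> *\<^sub>R \<xi> s) x \<and> x t\<^sub>0 = x\<^sub>0}"

definition flow_set ::
    "(real \<Rightarrow> real^'n^'n) \<Rightarrow> real \<Rightarrow> real \<Rightarrow> real \<Rightarrow> (real^'n) set \<Rightarrow> (real^'n) set" where
  "flow_set L \<rho> t t\<^sub>0 M = (\<Union>x\<in>M. flow L \<rho> t t\<^sub>0 x)"

definition uniformly_bounded :: "(real \<Rightarrow> 'a::metric_space set) \<Rightarrow> bool" where
  "uniformly_bounded M \<longleftrightarrow> (\<exists>y r. \<forall>t. M t \<subseteq> cball y r)"

definition invariant_set ::
    "(real \<Rightarrow> real^'n^'n) \<Rightarrow> real \<Rightarrow> (real \<Rightarrow> (real^'n) set) \<Rightarrow> bool" where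
  "invariant_set L \<rho> M \<longleftrightarrow>
     (\<forall>t. M t \<noteq> {} \<and> compact (M t)) \<and> (\<forall>t\<^sub>0 t. t\<^sub>0 < t \<longrightarrow> flow_set L \<rho> t t\<^sub>0 (M t\<^sub>0) = M t)"

text \<open>
  Invariant sets need not be uniformly bounded. For every vector \<open>v\<close>, the translate
  \<open>M t + \<Psi> t 0 v\<close> of a minimal invariant set \<open>M\<close> is again minimal invariant, so a minimal
  invariant set can be unique only within a class such as the uniformly bounded sets.
\<close>

definition minimal_invariant_set ::
    "(real \<Rightarrow> real^'n^'n) \<Rightarrow> real \<Rightarrow> (real \<Rightarrow> (real^'n) set) \<Rightarrow> bool" where
  "minimal_invariant_set L \<rho> M \<longleftrightarrow>
     invariant_set L \<rho> M \<and>
     \<not> (\<exists>N. (\<forall>t. N t \<noteq> {} \<and> closed (N t) \<and> N t \<subseteq> M t) \<and> N \<noteq> M \<and> invariant_set L \<rho> N)"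

text \<open>Extended-real-valued, so that the supremum over an unbounded set is \<open>\<infinity>\<close>.\<close>

definition semidist :: "'a::metric_space set \<Rightarrow> 'a set \<Rightarrow> ereal" where
  "semidist M\<^sub>1 M\<^sub>2 = (SUP x\<in>M\<^sub>1. INF y\<in>M\<^sub>2. ereal (dist x y))"

definition attractor ::
    "real \<Rightarrow> (real \<Rightarrow> real \<Rightarrow> real^'n^'n) \<Rightarrow> real \<Rightarrow> (real^'n) set" where
  "attractor \<rho> \<Psi> t = {x. \<exists>\<xi>\<in>controls. x = \<rho> *\<^sub>R (LINT s:{..t}|lebesgue. \<Psi> t s *v \<xi> s)}"

end

theory Submission
  imports Defs
begin

text \<open>
  Variation of constants gives
  \<open>\<Phi>\<^bsup>t,t\<^sub>0\<^esup>(x) = {\<Psi>(t,t\<^sub>0) x + \<rho> \<integral>\<^bsub>t\<^sub>0\<^esub>\<^bsup>t\<^esup> \<Psi>(t,s) \<xi>(s) ds | \<xi> \<in> \<U>}\<close>. Splitting the integral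
  that defines \<open>A\<^sub>t\<close> at \<open>t\<^sub>0\<close> and concatenating controls shows that \<open>\<A>\<close> is invariant. Two
  solutions driven by the same control approach each other exponentially; hence any two uniformly
  bounded invariant sets coincide, which yields minimality and uniqueness, and comparing with
  \<open>\<A>\<close> yields both kinds of attraction. That \<open>A\<^sub>t\<close> is closed is the remaining point, and weak-star
  compactness of \<open>\<U>\<close> is avoided: \<open>A\<^sub>t\<close> is convex, a point of its closure outside it would lie on a
  supporting hyperplane with normal \<open>p\<close>, and \<open>p\<close> is maximised by the single control
  \<open>\<Psi>(t,s)\<^sup>T p / |\<Psi>(t,s)\<^sup>T p|\<close>, to which every maximising sequence of controls converges almost
  everywhere along a subsequence.
\<close>

subsection \<open>Absolutely continuous functions\<close>

text \<open>As \<open>L\<close> is merely locally integrable, \<open>\<Psi>\<close> has a derivative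
  only almost everywhere, and each use of a differential equation passes through absolute
  continuity: such a function is recovered from its a.e. derivative, and an indefinite integral is
  differentiable a.e. The hypotheses describe \<open>\<Psi> t s\<close> as a function of
  \<open>t\<close>, whereas variation of constants differentiates in \<open>s\<close>; the cocycle
  law, itself a uniqueness statement for the matrix equation, transfers the regularity. Closedness
  rests on two facts. \<open>\<Psi> t s\<close> is invertible, so \<open>p v* \<Psi> t s\<close>
  never vanishes and the maximising control is determined at every past time. The Euclidean ball is
  strictly convex: if |e| = 1 and |x| \<le> 1, then |x - e|^2 \<le> 2 (1 - e . x), so a small loss
  in the linear functional forces x towards e. A loss that is small in the mean thus becomes a.e.
  convergence along a subsequence, and the stability bound dominates the integrands. The radius
  \<rho> \<kappa> / \<gamma> of the attractor is the integral of that bound over the past, times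
  \<rho>.\<close>

lemma division_of_real_ends:
  fixes T :: "real set"
  assumes "D division_of T" "k \<in> D"
  shows "Inf k \<le> Sup k" "Inf k \<in> T" "Sup k \<in> T" "k = {Inf k..Sup k}"
proof -
  obtain u v where k: "k = cbox u v" using cbox_division_memE[OF assms(2,1)] by metis
  have "k \<noteq> {}" "k \<subseteq> T" using assms division_ofD(2,3) by metis+
  then show "Inf k \<le> Sup k" "Inf k \<in> T" "Sup k \<in> T" "k = {Inf k..Sup k}" using k by auto
qed

lemma absolutely_continuous_onI:
  assumes "\<And>\<epsilon>. \<epsilon> > 0 \<Longrightarrow> \<exists>\<delta>>0. \<forall>D T. D division_of T \<and> T \<subseteq> S \<and>
    (\<Sum>k\<in>D. Sup k - Inf k) < \<delta> \<longrightarrow> (\<Sum>k\<in>D. norm (f (Sup k) - f (Inf k))) < \<epsilon>"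
  shows "absolutely_continuous_on S f"
  using assms unfolding absolutely_continuous_on_def by simp

lemma absolutely_continuous_onE:
  assumes "absolutely_continuous_on S f" "\<epsilon> > 0"
  obtains \<delta> where "\<delta> > 0"
    "\<And>D T. D division_of T \<Longrightarrow> T \<subseteq> S \<Longrightarrow> (\<Sum>k\<in>D. Sup k - Inf k) < \<delta> \<Longrightarrow>
       (\<Sum>k\<in>D. norm (f (Sup k) - f (Inf k))) < \<epsilon>"
  using assms unfolding absolutely_continuous_on_def by metis

lemma absolutely_continuous_on_subset:
  "absolutely_continuous_on S f \<Longrightarrow> T \<subseteq> S \<Longrightarrow> absolutely_continuous_on T f"
  unfolding absolutely_continuous_on_def by (meson subset_trans)

lemma absolutely_continuous_on_ident: "absolutely_continuous_on S (\<lambda>x. x)"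
proof (rule absolutely_continuous_onI)
  fix \<epsilon> :: real assume "\<epsilon> > 0"
  have "(\<Sum>k\<in>D. norm (Sup k - Inf k)) = (\<Sum>k\<in>D. Sup k - Inf k)"
    if "D division_of T" for D and T :: "real set"
    using division_of_real_ends(1)[OF that] by (intro sum.cong) simp_all
  then show "\<exists>\<delta>>0. \<forall>D T. D division_of T \<and> T \<subseteq> S \<and> (\<Sum>k\<in>D. Sup k - Inf k) < \<delta> \<longrightarrow>
      (\<Sum>k\<in>D. norm (Sup k - Inf k)) < \<epsilon>"
    using \<open>\<epsilon> > 0\<close> by (intro exI[of _ \<epsilon>] conjI allI impI) (simp, metis)
qed

text \<open>The closure properties needed below are all instances: constants, sums, negatives,
  Lipschitz functions (dominated by the identity), bilinear products, and \<open>\<Psi>\<close> in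
  its second argument. Two dominating functions let sums and products fit directly.\<close>

lemma absolutely_continuous_on_dominated:
  assumes f: "absolutely_continuous_on S f" and g: "absolutely_continuous_on S g"
    and dom: "\<And>x y. x \<in> S \<Longrightarrow> y \<in> S \<Longrightarrow> x \<le> y \<Longrightarrow>
      norm (h y - h x) \<le> C * (norm (f y - f x) + norm (g y - g x))"
  shows "absolutely_continuous_on S h"
proof (rule absolutely_continuous_onI)
  fix \<epsilon> :: real assume \<epsilon>: "\<epsilon> > 0"
  \<comment> \<open>One half for each of \<open>f\<close> and \<open>g\<close>;
    \<open>\<bar>C\<bar> + 1\<close> is positive whatever the sign of \<open>C\<close>.\<close>
  define \<epsilon>' where "\<epsilon>' = \<epsilon> / (2 * (\<bar>C\<bar> + 1))"
  have \<epsilon>': "\<epsilon>' > 0" using \<epsilon> by (simp add: \<epsilon>'_def add_nonneg_pos)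
  obtain d1 where d1: "d1 > 0" "\<And>D T. D division_of T \<Longrightarrow> T \<subseteq> S \<Longrightarrow> (\<Sum>k\<in>D. Sup k - Inf k) < d1 \<Longrightarrow>
       (\<Sum>k\<in>D. norm (f (Sup k) - f (Inf k))) < \<epsilon>'"
    using absolutely_continuous_onE[OF f \<epsilon>'] by metis
  obtain d2 where d2: "d2 > 0" "\<And>D T. D division_of T \<Longrightarrow> T \<subseteq> S \<Longrightarrow> (\<Sum>k\<in>D. Sup k - Inf k) < d2 \<Longrightarrow>
       (\<Sum>k\<in>D. norm (g (Sup k) - g (Inf k))) < \<epsilon>'"
    using absolutely_continuous_onE[OF g \<epsilon>'] by metis
  have "(\<Sum>k\<in>D. norm (h (Sup k) - h (Inf k))) < \<epsilon>"
    if D: "D division_of T" "T \<subseteq> S" "(\<Sum>k\<in>D. Sup k - Inf k) < min d1 d2" for D T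
  proof -
    let ?F = "\<lambda>k. norm (f (Sup k) - f (Inf k))" and ?G = "\<lambda>k. norm (g (Sup k) - g (Inf k))"
    have "norm (h (Sup k) - h (Inf k)) \<le> (\<bar>C\<bar> + 1) * (?F k + ?G k)" if "k \<in> D" for k
    proof -
      note e = division_of_real_ends[OF D(1) that]
      have "norm (h (Sup k) - h (Inf k)) \<le> C * (?F k + ?G k)"
        using e D(2) by (intro dom) auto
      also have "\<dots> \<le> (\<bar>C\<bar> + 1) * (?F k + ?G k)"
        by (intro mult_right_mono) auto
      finally show ?thesis .
    qed
    then have "(\<Sum>k\<in>D. norm (h (Sup k) - h (Inf k))) \<le> (\<Sum>k\<in>D. (\<bar>C\<bar> + 1) * (?F k + ?G k))"
      by (rule sum_mono)
    also have "\<dots> = (\<bar>C\<bar> + 1) * (sum ?F D + sum ?G D)"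
      by (simp add: sum_distrib_left[symmetric] sum.distrib)
    also have "\<dots> < (\<bar>C\<bar> + 1) * (\<epsilon>' + \<epsilon>')"
      using d1(2)[OF D(1,2)] d2(2)[OF D(1,2)] D(3) by (intro mult_strict_left_mono add_strict_mono) auto
    also have "\<dots> = \<epsilon>"
    proof -
      have "c * (\<epsilon> / (2 * c) + \<epsilon> / (2 * c)) = \<epsilon>" if "c > 0" for c
        using that by (simp add: field_simps)
      then show ?thesis unfolding \<epsilon>'_def by (metis abs_ge_zero add_nonneg_pos zero_less_one)
    qed
    finally show ?thesis .
  qed
  then show "\<exists>\<delta>>0. \<forall>D T. D division_of T \<and> T \<subseteq> S \<and> (\<Sum>k\<in>D. Sup k - Inf k) < \<delta> \<longrightarrow>
      (\<Sum>k\<in>D. norm (h (Sup k) - h (Inf k))) < \<epsilon>"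
    using d1(1) d2(1) by (intro exI[of _ "min d1 d2"] conjI allI impI) (simp, metis)
qed

lemma absolutely_continuous_on_imp_continuous_on:
  assumes "absolutely_continuous_on {a..b} f"
  shows "continuous_on {a..b} f"
proof -
  have "\<exists>d>0. \<forall>y\<in>{a..b}. dist y x < d \<longrightarrow> dist (f y) (f x) < e" if x: "x \<in> {a..b}" and "e > 0" for x e
  proof -
    obtain d where d: "d > 0" "\<And>D T. D division_of T \<Longrightarrow> T \<subseteq> {a..b} \<Longrightarrow> (\<Sum>k\<in>D. Sup k - Inf k) < d \<Longrightarrow>
       (\<Sum>k\<in>D. norm (f (Sup k) - f (Inf k))) < e"
      using absolutely_continuous_onE[OF assms \<open>e > 0\<close>] by metis
    have *: "norm (f v - f u) < e" if "u \<in> {a..b}" "v \<in> {a..b}" "u \<le> v" "v - u < d" for u v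
    proof -
      have "{{u..v}} division_of {u..v}"
        using division_of_self[of u v] that by simp
      from d(2)[OF this] show ?thesis using that by simp
    qed
    have "dist (f y) (f x) < e" if "y \<in> {a..b}" "dist y x < d" for y
      using *[of x y] *[of y x] x that by (cases "x \<le> y") (auto simp: dist_norm norm_minus_commute)
    then show ?thesis using d(1) by blast
  qed
  then show ?thesis unfolding continuous_on_iff by blast
qed

section \<open>The fundamental theorem of calculus for absolutely continuous functions\<close>

text \<open>Two members overlap in a convex set with empty interior, hence in a null set. This turns
  the total length in \<open>absolutely_continuous_on\<close> into a measure, which an enclosing
  open set can control.\<close>

lemma measure_Union_division:
  assumes "D division_of S"
  shows "measure lebesgue (\<Union>D) = (\<Sum>k\<in>D. Sup k - Inf (k::real set))"
proof -
  have "measure lebesgue (\<Union>D) = (\<Sum>k\<in>D. measure lebesgue k)"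
  proof (rule measure_negligible_finite_Union)
    show "finite D" using assms by (rule division_of_finite)
    show "k \<in> lmeasurable" if "k \<in> D" for k
      using cbox_division_memE[OF that assms] lmeasurable_cbox by metis
    show "pairwise (\<lambda>S T. negligible (S \<inter> T)) D"
    proof (rule pairwiseI)
      fix K M assume KM: "K \<in> D" "M \<in> D" "K \<noteq> M"
      have "interior (K \<inter> M) = {}"
        using division_ofD(5)[OF assms KM] by (simp only: interior_Int)
      moreover have "convex K" "convex M"
        using cbox_division_memE[OF _ assms] KM convex_box(1) by metis+
      then have "convex (K \<inter> M)" by (rule convex_Int)
      ultimately show "negligible (K \<inter> M)" by (simp only: negligible_convex_interior)
    qed
  qed
  also have "\<dots> = (\<Sum>k\<in>D. Sup k - Inf k)"
  proof (rule sum.cong[OF refl])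
    fix k assume "k \<in> D"
    note e = division_of_real_ends[OF assms this]
    show "measure lebesgue k = Sup k - Inf k"
      by (subst e(4)) (use e(1) in simp)
  qed
  finally show ?thesis .
qed

text \<open>The gauge integral compares Riemann sums with increments of \<open>f\<close> directly,
  so the integrability of \<open>g\<close> comes out together with the value of its
  integral.\<close>

lemma absolutely_continuous_on_has_integral:
  fixes f :: "real \<Rightarrow> 'a::banach"
  assumes ab: "a \<le> b" and f: "absolutely_continuous_on {a..b} f"
    and g: "AE t in lebesgue. t \<in> {a..b} \<longrightarrow> (f has_vector_derivative g t) (at t within {a..b})"
  shows "(g has_integral (f b - f a)) {a..b}"
proof -
  obtain N where N: "N \<in> null_sets lebesgue"
    "\<And>t. t \<notin> N \<Longrightarrow> t \<in> {a..b} \<Longrightarrow> (f has_vector_derivative g t) (at t within {a..b})"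
    using AE_E3[OF g] by auto
  define h where "h t = (if t \<in> N then 0 else g t)" for t
  \<comment> \<open>Tags off \<open>N\<close> are controlled by the derivative; the intervals with tags in \<open>N\<close> lie in an
    open set \<open>U\<close> of measure less than the \<open>\<delta>\<close> of absolute continuity.\<close>
  have "\<exists>\<gamma>. gauge \<gamma> \<and> (\<forall>D. D tagged_division_of {a..b} \<and> \<gamma> fine D \<longrightarrow>
      norm ((\<Sum>(x,k)\<in>D. measure lborel k *\<^sub>R h x) - (f b - f a)) < e)" if "e > 0" for e
  proof -
    \<comment> \<open>Tags off \<open>N\<close> then contribute at most \<open>e' * (b - a)\<close>,
      which is below \<open>e / 2\<close>; the summand 1 covers \<open>a = b\<close>.\<close>
    define e' where "e' = e / (2 * (b - a + 1))"
    have e': "e' > 0" using \<open>e > 0\<close> ab by (simp add: e'_def)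
    have e2: "e / 2 > 0" using \<open>e > 0\<close> by simp
    obtain d where d: "d > 0" "\<And>D T. D division_of T \<Longrightarrow> T \<subseteq> {a..b} \<Longrightarrow> (\<Sum>k\<in>D. Sup k - Inf k) < d \<Longrightarrow>
       (\<Sum>k\<in>D. norm (f (Sup k) - f (Inf k))) < e / 2"
      using absolutely_continuous_onE[OF f e2] by metis
    have "N \<in> sets lebesgue" using N(1) by auto
    obtain U where U: "open U" "N \<subseteq> U" "U - N \<in> lmeasurable" "emeasure lebesgue (U - N) < ennreal d"
      using sets_lebesgue_outer_open[OF \<open>N \<in> sets lebesgue\<close> d(1)] by metis
    have UU: "U = (U - N) \<union> N" using U(2) by blast
    have "N \<in> lmeasurable" using N(1) by (simp add: negligible_iff_null_sets negligible_imp_measurable)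
    then have Um: "U \<in> lmeasurable" using U(3) UU by (metis fmeasurable.Un)
    have "emeasure lebesgue U < ennreal d"
      using U(4) emeasure_Un_null_set[OF fmeasurableD[OF U(3)] N(1)] UU by simp
    then have Ud: "measure lebesgue U < d"
      using Um d(1) by (simp add: emeasure_eq_measure2 ennreal_less_iff)
    have "\<exists>r>0. (x \<in> N \<longrightarrow> ball x r \<subseteq> U) \<and> (x \<in> {a..b} - N \<longrightarrow> (\<forall>y\<in>{a..b}. norm (y - x) < r \<longrightarrow>
        norm (f y - f x - (y - x) *\<^sub>R g x) \<le> e' * norm (y - x)))" for x
    proof (cases "x \<in> N")
      case True
      then show ?thesis using U(1,2) open_contains_ball by (metis DiffD2 subsetD)
    next
      case False
      show ?thesis
      proof (cases "x \<in> {a..b}")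
        case True
        then show ?thesis
          using N(2)[OF False True] e' False
          unfolding has_vector_derivative_def has_derivative_within_alt by (metis)
      next
        case False': False
        show ?thesis using False False' by (intro exI[of _ 1] conjI impI) auto
      qed
    qed
    then obtain r where r: "\<And>x. r x > 0" "\<And>x. x \<in> N \<Longrightarrow> ball x (r x) \<subseteq> U"
      "\<And>x y. x \<in> {a..b} \<Longrightarrow> x \<notin> N \<Longrightarrow> y \<in> {a..b} \<Longrightarrow> norm (y - x) < r x \<Longrightarrow>
        norm (f y - f x - (y - x) *\<^sub>R g x) \<le> e' * norm (y - x)"
      by (metis DiffI)
    define \<gamma> where "\<gamma> x = ball x (r x)" for x
    have gau: "gauge \<gamma>" unfolding \<gamma>_def by (rule gauge_ball_dependent) (use r(1) in blast)
    have "norm ((\<Sum>(x,k)\<in>D. measure lborel k *\<^sub>R h x) - (f b - f a)) < e"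
      if D: "D tagged_division_of {a..b}" and fine: "\<gamma> fine D" for D
    proof -
      have finD: "finite D" using D by (rule tagged_division_of_finite)
      define t where "t p = measure lborel (snd p) *\<^sub>R h (fst p) - (f (Sup (snd p)) - f (Inf (snd p)))" for p
      define D1 where "D1 = {p\<in>D. fst p \<notin> N}"
      define D2 where "D2 = {p\<in>D. fst p \<in> N}"
      have cell: "Inf k \<le> Sup k \<and> Inf k \<in> {a..b} \<and> Sup k \<in> {a..b} \<and> x \<in> {Inf k..Sup k} \<and>
          measure lborel k = Sup k - Inf k \<and> Inf k \<in> ball x (r x) \<and> Sup k \<in> ball x (r x) \<and> k \<subseteq> ball x (r x)"
        if xk: "(x, k) \<in> D" for x k
      proof -
        obtain u v where k: "k = cbox u v" using tagged_division_ofD(4)[OF D xk] by metis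
        have "x \<in> k" "k \<subseteq> {a..b}" using tagged_division_ofD(2,3)[OF D xk] by auto
        moreover have "k \<subseteq> ball x (r x)" using fineD[OF fine xk] by (simp add: \<gamma>_def)
        moreover have "u \<le> v" using \<open>x \<in> k\<close> k by simp
        then have "u \<in> k" "v \<in> k" using k by simp_all
        then have "u \<in> ball x (r x)" "v \<in> ball x (r x)"
          using \<open>k \<subseteq> ball x (r x)\<close> by (metis subsetD)+
        ultimately show ?thesis unfolding k by (auto simp del: mem_ball)
      qed
      have "(\<Sum>(x,k)\<in>D. measure lborel k *\<^sub>R h x) - (f b - f a) = (\<Sum>p\<in>D. t p)"
        unfolding additive_tagged_division_1[OF ab D, of f, symmetric] t_def
        by (simp add: sum_subtractf case_prod_unfold)
      also have "\<dots> = (\<Sum>p\<in>D1. t p) + (\<Sum>p\<in>D2. t p)"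
        unfolding D1_def D2_def using sum.union_inter_neutral[of D1 D2 t] finD
        by (subst sum.union_disjoint[symmetric]) (auto intro!: sum.cong)
      finally have eq: "(\<Sum>(x,k)\<in>D. measure lborel k *\<^sub>R h x) - (f b - f a) = (\<Sum>p\<in>D1. t p) + (\<Sum>p\<in>D2. t p)" .
      have "norm (\<Sum>p\<in>D1. t p) \<le> (\<Sum>p\<in>D1. e' * measure lborel (snd p))"
      proof (rule sum_norm_le)
        fix p assume "p \<in> D1"
        then obtain x k where p: "p = (x, k)" "(x, k) \<in> D" "x \<notin> N" unfolding D1_def by (cases p) auto
        note c = cell[OF p(2)]
        have xab: "x \<in> {a..b}" using c by auto
        \<comment> \<open>Straddle estimate: the tag lies between the endpoints, so the errors at
          the two ends add up to \<open>e'\<close> times the length of the cell.\<close>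
        have 1: "norm (f (Sup k) - f x - (Sup k - x) *\<^sub>R g x) \<le> e' * (Sup k - x)"
          using r(3)[OF xab p(3), of "Sup k"] c by (auto simp: dist_norm norm_minus_commute)
        have 2: "norm (f (Inf k) - f x - (Inf k - x) *\<^sub>R g x) \<le> e' * (x - Inf k)"
          using r(3)[OF xab p(3), of "Inf k"] c by (auto simp: dist_norm norm_minus_commute)
        have "t p = (f (Inf k) - f x - (Inf k - x) *\<^sub>R g x) - (f (Sup k) - f x - (Sup k - x) *\<^sub>R g x)"
        proof -
          have "measure lborel k = Sup k - Inf k" using c by blast
          then show ?thesis using p by (simp add: t_def h_def scaleR_left_diff_distrib)
        qed
        then have "norm (t p) \<le> e' * (x - Inf k) + e' * (Sup k - x)"
          using 1 2 norm_triangle_ineq4 by (metis add_mono order_trans)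
        also have "\<dots> = e' * (Sup k - Inf k)" by (simp add: algebra_simps)
        also have "\<dots> = e' * measure lborel (snd p)" using c p(1) by (metis snd_conv)
        finally show "norm (t p) \<le> e' * measure lborel (snd p)" .
      qed
      also have "\<dots> \<le> (\<Sum>p\<in>D. e' * measure lborel (snd p))"
        using e' finD by (intro sum_mono2) (auto simp: D1_def)
      also have "\<dots> = e' * (b - a)"
        using additive_content_tagged_division[of D a b] D ab
        by (simp add: sum_distrib_left[symmetric] case_prod_unfold)
      also have "\<dots> < e' * (b - a + 1)" using e' by simp
      also have "\<dots> = e / 2" using ab by (simp add: e'_def field_simps)
      finally have n1: "norm (\<Sum>p\<in>D1. t p) < e / 2" .
      have pD2: "D2 tagged_partial_division_of {a..b}"
        using tagged_partial_division_subset[of D "{a..b}" D2] D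
        by (auto simp: D2_def tagged_division_of_def)
      let ?T = "\<Union>(snd ` D2)"
      have div: "snd ` D2 division_of ?T" using pD2 by (rule partial_division_of_tagged_division)
      have Tab: "?T \<subseteq> {a..b}" using tagged_partial_division_ofD(3)[OF pD2] by force
      have TU: "?T \<subseteq> U"
      proof -
        have "k \<subseteq> U" if "(x, k) \<in> D2" for x k
          using that cell[of x k] r(2)[of x] by (auto simp: D2_def)
        then show ?thesis by force
      qed
      have "(\<Sum>k\<in>snd ` D2. Sup k - Inf k) = measure lebesgue ?T"
        using measure_Union_division[OF div] by simp
      also have "\<dots> \<le> measure lebesgue U"
        by (rule measure_mono_fmeasurable[OF TU _ Um]) (use lmeasurable_division[OF div] in auto)
      finally have "(\<Sum>k\<in>snd ` D2. norm (f (Sup k) - f (Inf k))) < e / 2"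
        using d(2)[OF div Tab] Ud by simp
      \<comment> \<open>Distinct tags may share a cell, but only one without interior.
        \<open>l\<close> vanishes on such cells, also on the empty set, where \<open>Inf\<close> and
        \<open>Sup\<close> are unspecified; so the sums over pairs and over cells agree.\<close>
      moreover define l where "l k = (if k = {} then 0 else norm (f (Sup k) - f (Inf k)))" for k
      have "(\<Sum>(x,k)\<in>D2. l k) = (\<Sum>k\<in>snd ` D2. l k)"
      proof (rule sum.over_tagged_division_lemma[OF tagged_partial_division_of_Union_self[OF pD2]])
        fix u v :: real assume "box u v = {}"
        then have "v \<le> u" by simp
        then show "l (cbox u v) = 0" by (cases "u = v") (auto simp: l_def)
      qed
      moreover have "(\<Sum>k\<in>snd ` D2. l k) \<le> (\<Sum>k\<in>snd ` D2. norm (f (Sup k) - f (Inf k)))"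
        by (rule sum_mono) (simp add: l_def)
      moreover have "norm (\<Sum>p\<in>D2. t p) \<le> (\<Sum>(x,k)\<in>D2. l k)"
      proof (rule sum_norm_le)
        fix p assume "p \<in> D2"
        then obtain x k where p: "p = (x, k)" "(x, k) \<in> D" "x \<in> N" unfolding D2_def by (cases p) auto
        have "k \<noteq> {}" using tagged_division_ofD(2)[OF D p(2)] by blast
        then show "norm (t p) \<le> (case p of (x, k) \<Rightarrow> l k)"
          using p by (simp add: t_def h_def l_def norm_minus_commute)
      qed
      ultimately have n2: "norm (\<Sum>p\<in>D2. t p) < e / 2" by simp
      show ?thesis unfolding eq using n1 n2 norm_triangle_ineq[of "\<Sum>p\<in>D1. t p" "\<Sum>p\<in>D2. t p"] by simp
    qed
    then show ?thesis using gau by blast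
  qed
  then have "(h has_integral (f b - f a)) {a..b}" unfolding has_integral_real by simp
  then show ?thesis
    by (rule has_integral_spike[of N, rotated 2])
      (use N(1) in \<open>auto simp: h_def negligible_iff_null_sets\<close>)
qed

section \<open>Almost everywhere differentiability of indefinite integrals\<close>

lemma has_vector_derivative_within_alt:
  "(f has_vector_derivative D) (at x within S) \<longleftrightarrow>
    (\<forall>e>0. \<exists>d>0. \<forall>y\<in>S. \<bar>y - x\<bar> < d \<longrightarrow> norm (f y - f x - (y - x) *\<^sub>R D) \<le> e * \<bar>y - x\<bar>)"
  unfolding has_vector_derivative_def has_derivative_within_alt
  by (simp add: bounded_linear_scaleR_left)

text \<open>This is the a.e. convergence of averages over cubes with lowest corner \<open>x\<close>,
  which in dimension one sees only the right side of \<open>x\<close>. The error is restated without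
  division to match the derivative criterion.\<close>

lemma lebesgue_differentiation_right:
  fixes g :: "real \<Rightarrow> 'a::euclidean_space"
  assumes "\<And>a b. g integrable_on {a..b}"
  obtains N where "negligible N"
    "\<And>x e. x \<notin> N \<Longrightarrow> 0 < e \<Longrightarrow>
      \<exists>d>0. \<forall>h. 0 < h \<and> h < d \<longrightarrow> norm (integral {x..x + h} g - h *\<^sub>R g x) \<le> e * h"
proof -
  have "g integrable_on cbox a b" for a b using assms by simp
  from integrable_ccontinuous_explicit[of g, OF this] obtain N where N: "negligible N"
    "\<And>x e. x \<notin> N \<Longrightarrow> 0 < e \<Longrightarrow> \<exists>d>0. \<forall>h. 0 < h \<and> h < d \<longrightarrow>
      norm (integral {x..x + h} g /\<^sub>R h - g x) < e"
    by (auto simp: Basis_real_def)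
  have "norm (integral {x..x + h} g - h *\<^sub>R g x) \<le> e * h"
    if "0 < h" "norm (integral {x..x + h} g /\<^sub>R h - g x) < e" for x h e
  proof -
    have "integral {x..x + h} g - h *\<^sub>R g x = h *\<^sub>R (integral {x..x + h} g /\<^sub>R h - g x)"
      using that(1) by (simp add: scaleR_diff_right)
    then have "norm (integral {x..x + h} g - h *\<^sub>R g x) = h * norm (integral {x..x + h} g /\<^sub>R h - g x)"
      using that(1) by (metis abs_of_pos norm_scaleR)
    then show ?thesis using that by (simp add: mult.commute)
  qed
  then show ?thesis using N that by metis
qed

text \<open>Left increments are right increments of the reflected function, whose exceptional set
  \<open>N2\<close> is reflected back.\<close>

lemma integral_has_vector_derivative_AE:
  fixes g :: "real \<Rightarrow> 'a::euclidean_space"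
  assumes g: "g integrable_on {a..b}"
  shows "AE t in lebesgue. t \<in> {a..b} \<longrightarrow>
    ((\<lambda>u. integral {a..u} g) has_vector_derivative g t) (at t within {a..b})"
proof -
  \<comment> \<open>Extension by zero, because the one-sided result asks for integrability on all
    intervals, also beyond \<open>a\<close> and \<open>b\<close>.\<close>
  define G where "G t = (if t \<in> {a..b} then g t else 0)" for t
  have "G integrable_on UNIV" unfolding G_def using g by (simp only: integrable_restrict_UNIV)
  then have G: "G integrable_on {c..d}" for c d by (rule integrable_on_subinterval) simp
  have Gm: "(\<lambda>x. G (- x)) integrable_on {c..d}" for c d
    using G[of "-d" "-c"] Henstock_Kurzweil_Integration.integrable_reflect_real[of G "-c" "-d"] by simp
  obtain N1 where N1: "negligible N1"
    "\<And>x e. x \<notin> N1 \<Longrightarrow> 0 < e \<Longrightarrow>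
      \<exists>d>0. \<forall>h. 0 < h \<and> h < d \<longrightarrow> norm (integral {x..x + h} G - h *\<^sub>R G x) \<le> e * h"
    using lebesgue_differentiation_right[of G, OF G] by metis
  obtain N2 where N2: "negligible N2"
    "\<And>x e. x \<notin> N2 \<Longrightarrow> 0 < e \<Longrightarrow>
      \<exists>d>0. \<forall>h. 0 < h \<and> h < d \<longrightarrow> norm (integral {x..x + h} (\<lambda>x. G (- x)) - h *\<^sub>R G (- x)) \<le> e * h"
    using lebesgue_differentiation_right[of "\<lambda>x. G (- x)", OF Gm] by metis
  have neg: "negligible (N1 \<union> uminus ` N2)"
    by (rule negligible_Un[OF N1(1)], rule negligible_differentiable_image_negligible[OF _ N2(1)])
      (auto intro: derivative_intros)
  have FG: "integral {a..u} g = integral {a..u} G" if "u \<in> {a..b}" for u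
    by (rule integral_cong) (use that in \<open>auto simp: G_def\<close>)
  have split: "integral {a..v} G - integral {a..u} G = integral {u..v} G" if "a \<le> u" "u \<le> v" for u v
    using Henstock_Kurzweil_Integration.integral_combine[OF that G] by (simp add: algebra_simps)
  have "((\<lambda>u. integral {a..u} g) has_vector_derivative g t) (at t within {a..b})"
    if t: "t \<notin> N1 \<union> uminus ` N2" "t \<in> {a..b}" for t
    unfolding has_vector_derivative_within_alt
  proof (intro allI impI)
    fix e :: real assume e: "e > 0"
    obtain d1 where d1: "d1 > 0" "\<And>h. 0 < h \<Longrightarrow> h < d1 \<Longrightarrow> norm (integral {t..t + h} G - h *\<^sub>R G t) \<le> e * h"
      using N1(2)[OF _ e, of t] t by auto
    have "- t \<notin> N2" using t(1) by force
    then obtain d2 where d2: "d2 > 0"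
      "\<And>h. 0 < h \<Longrightarrow> h < d2 \<Longrightarrow> norm (integral {- t..- t + h} (\<lambda>x. G (- x)) - h *\<^sub>R G (- (- t))) \<le> e * h"
      using N2(2)[OF _ e, of "- t"] by auto
    have "norm (integral {a..y} g - integral {a..t} g - (y - t) *\<^sub>R g t) \<le> e * \<bar>y - t\<bar>"
      if y: "y \<in> {a..b}" "\<bar>y - t\<bar> < min d1 d2" for y
    proof -
      have gt: "g t = G t" using t(2) by (simp add: G_def)
      consider "y = t" | "y > t" | "y < t" by linarith
      then show ?thesis
      proof cases
        case 2
        have "integral {a..y} g - integral {a..t} g = integral {t..t + (y - t)} G"
          using FG y(1) t(2) split[of t y] 2 by simp
        then show ?thesis using d1(2)[of "y - t"] 2 y(2) gt by simp
      next
        case 3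
        have "integral {- t..- t + (t - y)} (\<lambda>x. G (- x)) = integral {y..t} G"
          using Henstock_Kurzweil_Integration.integral_reflect_real[of t y G] by simp
        moreover have "integral {a..y} g - integral {a..t} g = - integral {y..t} G"
          using FG y(1) t(2) split[of y t] 3 by (simp add: algebra_simps)
        moreover have "norm (integral {- t..- t + (t - y)} (\<lambda>x. G (- x)) - (t - y) *\<^sub>R G (- (- t))) \<le> e * (t - y)"
          using d2(2)[of "t - y"] 3 y(2) by simp
        moreover have "norm (- integral {y..t} G - (y - t) *\<^sub>R G t) = norm (integral {y..t} G - (t - y) *\<^sub>R G t)"
          by (subst norm_minus_cancel[symmetric]) (simp add: algebra_simps)
        ultimately show ?thesis using 3 gt by simp
      qed simp
    qed
    then show "\<exists>d>0. \<forall>y\<in>{a..b}. \<bar>y - t\<bar> < d \<longrightarrow>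
        norm (integral {a..y} g - integral {a..t} g - (y - t) *\<^sub>R g t) \<le> e * \<bar>y - t\<bar>"
      using d1(1) d2(1) by (intro exI[of _ "min d1 d2"] conjI ballI impI) simp_all
  qed
  moreover have "AE t in lebesgue. t \<notin> N1 \<union> uminus ` N2"
    using neg by (intro AE_not_in) (simp only: negligible_iff_null_sets)
  ultimately show ?thesis by (elim eventually_mono) blast
qed

text \<open>An essentially bounded integrand has a Lipschitz integral. This case suffices for
  constructing solutions, where the integrand is \<open>\<Psi> t\<^sub>0 s *v \<xi> s\<close> on a
  compact interval.\<close>

lemma absolutely_continuous_on_integral:
  fixes g :: "real \<Rightarrow> 'a::euclidean_space"
  assumes g: "g absolutely_integrable_on {a..b}" and bd: "AE t in lebesgue. t \<in> {a..b} \<longrightarrow> norm (g t) \<le> C"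
  shows "absolutely_continuous_on {a..b} (\<lambda>u. integral {a..u} g)"
proof (rule absolutely_continuous_on_dominated[OF absolutely_continuous_on_ident absolutely_continuous_on_ident])
  fix x y :: real assume xy: "x \<in> {a..b}" "y \<in> {a..b}" "x \<le> y"
  have gi: "g integrable_on {u..v}" if "a \<le> u" "v \<le> b" for u v
    using integrable_on_subinterval[OF set_lebesgue_integral_eq_integral(1)[OF g], of u v] that by auto
  obtain N where N: "N \<in> null_sets lebesgue" "\<And>t. t \<notin> N \<Longrightarrow> t \<in> {a..b} \<Longrightarrow> norm (g t) \<le> C"
    using AE_E3[OF bd] by auto
  define h where "h t = (if t \<in> N then 0 else g t)" for t
  have hg: "integral {x..y} g = integral {x..y} h"
    by (rule integral_spike[of N]) (use N(1) in \<open>auto simp: h_def negligible_iff_null_sets\<close>)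
  have "h integrable_on {x..y}"
    by (rule integrable_spike[OF gi[of x y], of N]) (use N(1) xy in \<open>auto simp: h_def negligible_iff_null_sets\<close>)
  moreover have "norm (h t) \<le> \<bar>C\<bar>" if "t \<in> {x..y}" for t
    using N(2)[of t] that xy by (auto simp: h_def)
  ultimately have "norm (integral {x..y} h) \<le> \<bar>C\<bar> * (y - x)"
    using integrable_bound[of "\<bar>C\<bar>" h x y] xy by simp
  moreover have "integral {a..y} g - integral {a..x} g = integral {x..y} g"
    using Henstock_Kurzweil_Integration.integral_combine[of a x y g, OF _ _ gi[of a y]] xy by (simp add: algebra_simps)
  ultimately show "norm (integral {a..y} g - integral {a..x} g) \<le> \<bar>C\<bar> * (norm (y - x) + norm (y - x))"
    using hg xy mult_nonneg_nonneg[of "\<bar>C\<bar>" "y - x"] by (simp add: algebra_simps)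
qed

lemma absolutely_continuous_on_bilinear:
  assumes bb: "bounded_bilinear pr" and f: "absolutely_continuous_on {a..b} f" and g: "absolutely_continuous_on {a..b} g"
  shows "absolutely_continuous_on {a..b} (\<lambda>t. pr (f t) (g t))"
proof -
  interpret bounded_bilinear pr by fact
  obtain K where K: "K > 0" "\<And>x y. norm (pr x y) \<le> norm x * norm y * K" using pos_bounded by blast
  have "bounded (f ` {a..b})" "bounded (g ` {a..b})"
    using f g by (auto intro!: compact_imp_bounded compact_continuous_image absolutely_continuous_on_imp_continuous_on)
  then obtain F G where F: "F > 0" "\<And>t. t \<in> {a..b} \<Longrightarrow> norm (f t) \<le> F"
    and G: "G > 0" "\<And>t. t \<in> {a..b} \<Longrightarrow> norm (g t) \<le> G"
    unfolding bounded_pos by auto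
  show ?thesis
  proof (rule absolutely_continuous_on_dominated[OF f g])
    fix x y assume xy: "x \<in> {a..b}" "y \<in> {a..b}"
    have "pr (f y) (g y) - pr (f x) (g x) = pr (f y - f x) (g y) + pr (f x) (g y - g x)"
      by (simp add: diff_left diff_right)
    then have "norm (pr (f y) (g y) - pr (f x) (g x)) \<le> norm (pr (f y - f x) (g y)) + norm (pr (f x) (g y - g x))"
      by (simp only: norm_triangle_ineq)
    also have "\<dots> \<le> norm (f y - f x) * norm (g y) * K + norm (f x) * norm (g y - g x) * K"
      by (intro add_mono K(2))
    also have "\<dots> \<le> norm (f y - f x) * G * K + F * norm (g y - g x) * K"
      using F G xy K(1) by (intro add_mono mult_right_mono mult_left_mono) auto
    also have "\<dots> \<le> norm (f y - f x) * (F + G) * K + (F + G) * norm (g y - g x) * K"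
      using F(1) G(1) K(1) by (intro add_mono mult_right_mono mult_left_mono) auto
    also have "\<dots> = ((F + G) * K) * (norm (f y - f x) + norm (g y - g x))" by (simp add: algebra_simps)
    finally show "norm (pr (f y) (g y) - pr (f x) (g x)) \<le> ((F + G) * K) * (norm (f y - f x) + norm (g y - g x))" .
  qed
qed

subsection \<open>Matrix products as bounded bilinear maps\<close>

lemma bounded_bilinear_matrix_vector_mult:
  "bounded_bilinear ((*v) :: real^'n^'m \<Rightarrow> real^'n \<Rightarrow> real^'m)"
  unfolding bilinear_conv_bounded_bilinear[symmetric] bilinear_def
  by (auto intro!: linearI simp: matrix_vector_mult_def vec_eq_iff sum.distrib sum_distrib_left algebra_simps)

lemma bounded_bilinear_matrix_matrix_mult:
  "bounded_bilinear ((**) :: real^'n^'m \<Rightarrow> real^'p^'n \<Rightarrow> real^'p^'m)"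
  unfolding bilinear_conv_bounded_bilinear[symmetric] bilinear_def
  by (auto intro!: linearI simp: matrix_matrix_mult_def vec_eq_iff sum.distrib sum_distrib_left algebra_simps)

lemma absolutely_continuous_on_const: "absolutely_continuous_on S (\<lambda>x. c)"
  by (rule absolutely_continuous_on_dominated[OF absolutely_continuous_on_ident absolutely_continuous_on_ident, where C = 0]) simp

lemma absolutely_continuous_on_add:
  assumes "absolutely_continuous_on S f" "absolutely_continuous_on S g"
  shows "absolutely_continuous_on S (\<lambda>x. f x + g x)"
proof (rule absolutely_continuous_on_dominated[OF assms, where C = 1])
  fix x y
  have "f y + g y - (f x + g x) = (f y - f x) + (g y - g x)" by simp
  then show "norm (f y + g y - (f x + g x)) \<le> 1 * (norm (f y - f x) + norm (g y - g x))"
    by (simp only: mult_1 norm_triangle_ineq)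
qed

lemma absolutely_continuous_on_minus:
  assumes "absolutely_continuous_on S f"
  shows "absolutely_continuous_on S (\<lambda>x. - f x)"
  by (rule absolutely_continuous_on_dominated[OF assms assms, where C = 1])
    (simp add: norm_minus_commute)

lemma continuous_on_UNIV_intervals:
  fixes f :: "real \<Rightarrow> 'a::topological_space"
  assumes "\<And>a b. continuous_on {a..b} f"
  shows "continuous_on UNIV f"
proof -
  have "isCont f x" for x
    using continuous_on_interior[OF assms[of "x - 1" "x + 1"], of x] by simp
  then show ?thesis by (simp add: continuous_at_imp_continuous_on)
qed

text \<open>With difference quotients a limit can be taken factor by factor in a product of three
  matrices, as \<open>psi_derivative_right\<close> requires.\<close>

lemma has_vector_derivative_iff_quotient:
  "(f has_vector_derivative D) (at x within S) \<longleftrightarrow>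
    ((\<lambda>y. (f y - f x) /\<^sub>R (y - x)) \<longlongrightarrow> D) (at x within S)"
proof -
  have "norm (f y - f x - (y - x) *\<^sub>R D) / norm (y - x) = norm ((f y - f x) /\<^sub>R (y - x) - D)" if "y \<noteq> x" for y
  proof -
    have "(f y - f x) /\<^sub>R (y - x) - D = (f y - f x - (y - x) *\<^sub>R D) /\<^sub>R (y - x)"
      using that by (simp add: scaleR_diff_right)
    then show ?thesis by (simp add: divide_inverse mult.commute abs_inverse)
  qed
  then have "((\<lambda>y. norm (f y - f x - (y - x) *\<^sub>R D) / norm (y - x)) \<longlongrightarrow> 0) (at x within S) \<longleftrightarrow>
      ((\<lambda>y. norm ((f y - f x) /\<^sub>R (y - x) - D)) \<longlongrightarrow> 0) (at x within S)"
    by (intro tendsto_cong) (simp add: eventually_at_filter)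
  then show ?thesis
    unfolding has_vector_derivative_def has_derivative_iff_norm
    by (simp add: bounded_linear_scaleR_left tendsto_norm_zero_iff LIM_zero_iff)
qed

text \<open>Stability is stated in the operator norm, while absolute continuity of matrix functions
  refers to the Euclidean norm of \<open>real^'n^'m\<close>.\<close>

lemma norm_matrix_le_onorm:
  fixes A :: "real^'n^'m"
  shows "norm A \<le> real CARD('m) * real CARD('n) * onorm ((*v) A)"
proof -
  have "norm A \<le> (\<Sum>i\<in>UNIV. norm (A $ i))" unfolding norm_vec_def by (rule L2_set_le_sum) simp
  also have "\<dots> \<le> (\<Sum>i\<in>UNIV. \<Sum>j\<in>UNIV. \<bar>A $ i $ j\<bar>)" by (intro sum_mono norm_le_l1_cart)
  also have "\<dots> \<le> (\<Sum>i\<in>(UNIV::'m set). \<Sum>j\<in>(UNIV::'n set). onorm ((*v) A))"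
    by (intro sum_mono matrix_component_le_onorm)
  finally show ?thesis by simp
qed

subsection \<open>Linear differential equations\<close>

text \<open>The zero set of \<open>Y\<close> is open, because \<open>|Y|\<close> is at most half of its maximum on any interval
  around a zero over which \<open>|L|\<close> has small integral.\<close>

lemma linear_ode_zero:
  fixes L :: "real \<Rightarrow> real^'n^'n" and Y :: "real \<Rightarrow> real^'n^'n"
  assumes L: "locally_integrable L"
    and AC: "\<And>a b. absolutely_continuous_on {a..b} Y"
    and der: "AE t in lebesgue. (Y has_vector_derivative L t ** Y t) (at t)"
    and zero: "Y s = 0"
  shows "Y t = 0"
proof -
  obtain K where K: "K > 0" "\<And>(A::real^'n^'n) (B::real^'n^'n). norm (A ** B) \<le> norm A * norm B * K"
    using bounded_bilinear.pos_bounded[OF bounded_bilinear_matrix_matrix_mult[where 'n='n and 'm='n and 'p='n]]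
    by blast
  have LI: "(\<lambda>t. norm (L t)) integrable_on {a..b}" for a b
    using L unfolding locally_integrable_def absolutely_integrable_on_def by blast
  have int: "((\<lambda>t. L t ** Y t) has_integral (Y b - Y a)) {a..b}" if "a \<le> b" for a b
    by (rule absolutely_continuous_on_has_integral[OF that AC])
      (use der in \<open>auto elim!: eventually_mono intro: has_vector_derivative_at_within\<close>)
  have cont: "continuous_on UNIV Y"
    by (rule continuous_on_UNIV_intervals) (rule absolutely_continuous_on_imp_continuous_on[OF AC])
  define Z where "Z = {t. Y t = 0}"
  have "closed Z"
    unfolding Z_def using continuous_closed_vimage[of "{0}" Y] cont
    by (simp add: vimage_def continuous_on_eq_continuous_at)
  have "\<exists>d>0. \<forall>t. \<bar>t - r\<bar> \<le> d \<longrightarrow> t \<in> Z" if r: "r \<in> Z" for r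
  proof -
    define I where "I u = integral {r - 1..u} (\<lambda>t. norm (L t))" for u
    have "continuous_on {r - 1..r + 1} I" unfolding I_def by (rule indefinite_integral_continuous_1[OF LI])
    \<comment> \<open>\<open>K\<close> bounds the matrix product. The deviations of \<open>I\<close>
      at two points near \<open>r\<close> add up to at most \<open>1 / (2 * K)\<close>, which
      produces the factor one half.\<close>
    then obtain d0 where d0: "d0 > 0" "\<And>u. u \<in> {r - 1..r + 1} \<Longrightarrow> \<bar>u - r\<bar> < d0 \<Longrightarrow> \<bar>I u - I r\<bar> < 1 / (4 * K)"
      unfolding continuous_on_iff dist_real_def using K(1)
      by (metis add.commute atLeastAtMost_iff diff_add_cancel divide_pos_pos le_add_same_cancel1 le_add_same_cancel2 less_eq_real_def mult_pos_pos zero_less_numeral zero_less_one)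
    \<comment> \<open>Halving admits points at distance exactly \<open>d\<close>; the bound 1 keeps
      them in the window on which \<open>I\<close> is known to be continuous.\<close>
    define d where "d = min (d0 / 2) 1"
    have d: "d > 0" "d < d0" "d \<le> 1" using d0(1) by (auto simp: d_def)
    have small: "integral {x..y} (\<lambda>t. norm (L t)) \<le> 1 / (2 * K)" if "r - d \<le> x" "x \<le> y" "y \<le> r + d" for x y
    proof -
      have "\<bar>I y - I r\<bar> < 1 / (4 * K)" "\<bar>I x - I r\<bar> < 1 / (4 * K)"
        using d0(2)[of x] d0(2)[of y] that d by auto
      moreover have "integral {x..y} (\<lambda>t. norm (L t)) = I y - I x"
        using Henstock_Kurzweil_Integration.integral_combine[of "r - 1" x y "\<lambda>t. norm (L t)", OF _ _ LI] that d
        by (simp add: I_def)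
      moreover have "1 / (2 * K) = 1 / (4 * K) + 1 / (4 * K)" by (simp add: field_simps)
      ultimately show ?thesis by linarith
    qed
    have "{r - d..r + d} \<noteq> {}" using d by simp
    moreover have "continuous_on {r - d..r + d} (\<lambda>t. norm (Y t))"
      using cont by (intro continuous_on_norm) (rule continuous_on_subset, auto)
    ultimately obtain m where m: "m \<in> {r - d..r + d}" "\<And>t. t \<in> {r - d..r + d} \<Longrightarrow> norm (Y t) \<le> norm (Y m)"
      using continuous_attains_sup[of "{r - d..r + d}" "\<lambda>t. norm (Y t)"] by auto
    have step: "norm (Y y - Y x) \<le> norm (Y m) / 2" if xy: "r - d \<le> x" "x \<le> y" "y \<le> r + d" for x y
    proof -
      have "norm (Y y - Y x) = norm (integral {x..y} (\<lambda>t. L t ** Y t))"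
        using integral_unique[OF int[OF xy(2)]] by simp
      also have "\<dots> \<le> integral {x..y} (\<lambda>t. (norm (Y m) * K) *\<^sub>R norm (L t))"
      proof (rule integral_norm_bound_integral)
        show "(\<lambda>t. L t ** Y t) integrable_on {x..y}" using int[OF xy(2)] by (rule has_integral_integrable)
        show "(\<lambda>t. (norm (Y m) * K) *\<^sub>R norm (L t)) integrable_on {x..y}" by (intro integrable_cmul LI)
        fix t assume "t \<in> {x..y}"
        then have "norm (Y t) \<le> norm (Y m)" using m(2)[of t] xy by auto
        then have "norm (L t) * norm (Y t) * K \<le> norm (L t) * norm (Y m) * K"
          using K(1) by (intro mult_right_mono mult_left_mono) auto
        then show "norm (L t ** Y t) \<le> (norm (Y m) * K) *\<^sub>R norm (L t)"
          using K(2)[of "L t" "Y t"] by (simp add: algebra_simps)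
      qed
      also have "\<dots> = (norm (Y m) * K) * integral {x..y} (\<lambda>t. norm (L t))" by simp
      also have "\<dots> \<le> (norm (Y m) * K) * (1 / (2 * K))"
        using small[OF xy] K(1) by (intro mult_left_mono) auto
      also have "\<dots> = norm (Y m) / 2" using K(1) by simp
      finally show ?thesis .
    qed
    have Yr: "Y r = 0" using r by (simp add: Z_def)
    have "norm (Y m) \<le> norm (Y m) / 2"
      using step[of r m] step[of m r] m(1) d Yr by (cases "r \<le> m") auto
    then have "norm (Y m) = 0" using norm_ge_zero[of "Y m"] by linarith
    then have "\<forall>t. \<bar>t - r\<bar> \<le> d \<longrightarrow> t \<in> Z"
      using m(2) by (auto simp: Z_def abs_le_iff)
    then show ?thesis using d(1) by blast
  qed
  then have "open Z" unfolding open_dist dist_real_def by (metis less_imp_le)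
  with \<open>closed Z\<close> have "Z = {} \<or> Z = UNIV" using clopen[of Z] by blast
  then show ?thesis using zero by (auto simp: Z_def)
qed

section \<open>The principal matrix solution in its two arguments\<close>

text \<open>\<open>\<kappa>\<close> and \<open>\<gamma>\<close> are parameters because they reappear
  in explicit bounds, such as \<open>\<kappa> / \<gamma>\<close> for responses.\<close>

locale stable_linear_system =
  fixes L :: "real \<Rightarrow> real^'n^'n" and \<Psi> :: "real \<Rightarrow> real \<Rightarrow> real^'n^'n" and \<kappa> \<gamma> :: real
  assumes locally_integrable: "locally_integrable L"
    and principal: "principal_matrix_solution L \<Psi>"
    and kappa: "\<kappa> \<ge> 1" and gamma: "\<gamma> > 0"
    and stable: "\<And>s t. s \<le> t \<Longrightarrow> onorm ((*v) (\<Psi> t s)) \<le> \<kappa> * exp (- \<gamma> * (t - s))"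
begin

lemma psi_absolutely_continuous: "absolutely_continuous_on {a..b} (\<lambda>t. \<Psi> t s)"
  using principal unfolding principal_matrix_solution_def caratheodory_solution_def by simp

lemma psi_derivative: "AE t in lebesgue. ((\<lambda>t. \<Psi> t s) has_vector_derivative L t ** \<Psi> t s) (at t)"
  using principal unfolding principal_matrix_solution_def caratheodory_solution_def by simp

lemma psi_refl [simp]: "\<Psi> s s = mat 1"
  using principal unfolding principal_matrix_solution_def by simp

text \<open>As functions of \<open>t\<close> both sides solve the matrix equation and agree at
  \<open>t = s\<close>, so their difference vanishes identically. The order of the times is
  arbitrary, which makes \<open>\<Psi> s t\<close> the inverse of \<open>\<Psi> t s\<close>.\<close>

lemma psi_cocycle: "\<Psi> t s ** \<Psi> s r = \<Psi> t r"
proof -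
  interpret mm: bounded_bilinear "(**) :: real^'n^'n \<Rightarrow> real^'n^'n \<Rightarrow> real^'n^'n"
    by (rule bounded_bilinear_matrix_matrix_mult)
  define Y where "Y t = \<Psi> t s ** \<Psi> s r + - \<Psi> t r" for t
  have "absolutely_continuous_on {a..b} Y" for a b
    unfolding Y_def
    by (intro absolutely_continuous_on_add absolutely_continuous_on_minus psi_absolutely_continuous
        absolutely_continuous_on_bilinear[OF bounded_bilinear_matrix_matrix_mult] absolutely_continuous_on_const)
  moreover have "AE t in lebesgue. (Y has_vector_derivative L t ** Y t) (at t)"
    using psi_derivative[of s] psi_derivative[of r]
  proof eventually_elim
    case (elim t)
    have "(Y has_vector_derivative (L t ** \<Psi> t s) ** \<Psi> s r + - (L t ** \<Psi> t r)) (at t)"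
      unfolding Y_def
      by (intro has_vector_derivative_add has_vector_derivative_minus elim(2)
          bounded_linear.has_vector_derivative[OF mm.bounded_linear_left elim(1)])
    moreover have "(L t ** \<Psi> t s) ** \<Psi> s r + - (L t ** \<Psi> t r) = L t ** Y t"
      by (simp add: Y_def matrix_mul_assoc mm.diff_right)
    ultimately show ?case by simp
  qed
  moreover have "Y s = 0" by (simp add: Y_def)
  ultimately have "Y t = 0" using linear_ode_zero[OF locally_integrable] by blast
  then show ?thesis by (simp add: Y_def)
qed

lemma psi_cocycle_vec: "\<Psi> t s *v (\<Psi> s r *v x) = \<Psi> t r *v x"
  by (simp add: matrix_vector_mul_assoc psi_cocycle)

lemma psi_inverse: "\<Psi> t s ** \<Psi> s t = mat 1" by (simp add: psi_cocycle)

lemma norm_psi_vec: "s \<le> t \<Longrightarrow> norm (\<Psi> t s *v x) \<le> \<kappa> * exp (- \<gamma> * (t - s)) * norm x"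
  using onorm[OF matrix_vector_mul_bounded_linear, of "\<Psi> t s" x] stable[of s t]
  by (meson mult_right_mono norm_ge_zero order_trans)

text \<open>Stability bounds \<open>\<Psi> b s\<close> for all \<open>s \<le> b\<close>, and
  \<open>\<Psi> T s = \<Psi> T b ** \<Psi> b s\<close> carries the bound to any \<open>T\<close>.
  Continuity in \<open>s\<close> cannot be invoked here, since it is derived from this
  bound.\<close>

lemma psi_bounded_past: "\<exists>B>0. \<forall>s\<le>b. norm (\<Psi> T s) \<le> B"
proof -
  obtain K where K: "K > 0" "\<And>(A::real^'n^'n) (B::real^'n^'n). norm (A ** B) \<le> norm A * norm B * K"
    using bounded_bilinear.pos_bounded[OF bounded_bilinear_matrix_matrix_mult[where 'n='n and 'm='n and 'p='n]]
    by blast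
  define M where "M = real CARD('n) * real CARD('n) * \<kappa>"
  have "norm (\<Psi> b s) \<le> M" if "s \<le> b" for s
  proof -
    have "norm (\<Psi> b s) \<le> real CARD('n) * real CARD('n) * onorm ((*v) (\<Psi> b s))" by (rule norm_matrix_le_onorm)
    also have "onorm ((*v) (\<Psi> b s)) \<le> \<kappa> * exp (- \<gamma> * (b - s))" using that by (rule stable)
    also have "\<dots> \<le> \<kappa> * 1" using kappa gamma that by (intro mult_left_mono) (auto simp: mult_le_0_iff)
    finally show ?thesis by (simp add: M_def mult_left_mono)
  qed
  then have "norm (\<Psi> T s) \<le> norm (\<Psi> T b) * M * K" if "s \<le> b" for s
    using K(2)[of "\<Psi> T b" "\<Psi> b s"] that K(1)
    by (simp add: psi_cocycle) (meson less_imp_le mult_left_mono mult_right_mono norm_ge_zero order_trans)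
  then show ?thesis by (intro exI[of _ "\<bar>norm (\<Psi> T b) * M * K\<bar> + 1"]) force
qed

text \<open>Reduces regularity of \<open>\<Psi>\<close> in its second argument to regularity in its first.\<close>

lemma psi_diff: "\<Psi> T y - \<Psi> T x = - (\<Psi> T y ** (\<Psi> y a - \<Psi> x a) ** \<Psi> a x)"
proof -
  interpret mm: bounded_bilinear "(**) :: real^'n^'n \<Rightarrow> real^'n^'n \<Rightarrow> real^'n^'n"
    by (rule bounded_bilinear_matrix_matrix_mult)
  show ?thesis by (simp add: mm.diff_right mm.diff_left psi_cocycle matrix_mul_assoc[symmetric])
qed

text \<open>In \<open>psi_diff\<close> with base time \<open>a\<close> the outer factors are
  bounded, so the increments are dominated by those of \<open>\<Psi> s a\<close> as a function of
  \<open>s\<close>.\<close>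

lemma psi_absolutely_continuous_right: "absolutely_continuous_on {a..b} (\<lambda>s. \<Psi> T s)"
proof -
  obtain K where K: "K > 0" "\<And>(A::real^'n^'n) (B::real^'n^'n). norm (A ** B) \<le> norm A * norm B * K"
    using bounded_bilinear.pos_bounded[OF bounded_bilinear_matrix_matrix_mult[where 'n='n and 'm='n and 'p='n]]
    by blast
  obtain B1 where B1: "B1 > 0" "\<And>s. s \<le> b \<Longrightarrow> norm (\<Psi> T s) \<le> B1" using psi_bounded_past by metis
  obtain B2 where B2: "B2 > 0" "\<And>s. s \<le> b \<Longrightarrow> norm (\<Psi> a s) \<le> B2" using psi_bounded_past by metis
  show ?thesis
  proof (rule absolutely_continuous_on_dominated[OF psi_absolutely_continuous psi_absolutely_continuous])
    fix x y assume xy: "x \<in> {a..b}" "y \<in> {a..b}"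
    let ?d = "norm (\<Psi> y a - \<Psi> x a)"
    have "norm (\<Psi> T y - \<Psi> T x) \<le> norm (\<Psi> T y ** (\<Psi> y a - \<Psi> x a)) * norm (\<Psi> a x) * K"
      unfolding psi_diff[of T y x a] norm_minus_cancel by (rule K(2))
    also have "\<dots> \<le> (norm (\<Psi> T y) * ?d * K) * norm (\<Psi> a x) * K"
      using K by (intro mult_right_mono) auto
    also have "\<dots> \<le> (B1 * ?d * K) * B2 * K"
      using B1 B2 K(1) xy by (intro mult_mono mult_nonneg_nonneg) auto
    also have "\<dots> \<le> (B1 * K * B2 * K) * (?d + ?d)"
      using B1(1) B2(1) K(1) by (simp add: algebra_simps)
    finally show "norm (\<Psi> T y - \<Psi> T x) \<le> (B1 * K * B2 * K) * (?d + ?d)" .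
  qed
qed

lemma psi_continuous_right: "continuous_on S (\<lambda>s. \<Psi> T s)"
  by (rule continuous_on_subset[of UNIV], rule continuous_on_UNIV_intervals)
    (auto intro: absolutely_continuous_on_imp_continuous_on psi_absolutely_continuous_right)

text \<open>The adjoint equation. Divide \<open>psi_diff\<close> with base time 0 by the increment:
  the outer factors are continuous or constant, and the quotient in the middle converges wherever
  \<open>\<Psi> s 0\<close> satisfies its equation in \<open>s\<close>.\<close>

lemma psi_derivative_right:
  "AE s in lebesgue. ((\<lambda>s. \<Psi> T s) has_vector_derivative - (\<Psi> T s ** L s)) (at s)"
  using psi_derivative[of 0]
proof eventually_elim
  case (elim r)
  interpret mm: bounded_bilinear "(**) :: real^'n^'n \<Rightarrow> real^'n^'n \<Rightarrow> real^'n^'n"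
    by (rule bounded_bilinear_matrix_matrix_mult)
  have "(\<Psi> T \<longlongrightarrow> \<Psi> T r) (at r)"
    using psi_continuous_right[of UNIV T] by (simp add: continuous_on_def)
  moreover have "((\<lambda>s. (\<Psi> s 0 - \<Psi> r 0) /\<^sub>R (s - r)) \<longlongrightarrow> L r ** \<Psi> r 0) (at r)"
    using elim unfolding has_vector_derivative_iff_quotient .
  ultimately have "((\<lambda>s. - (\<Psi> T s ** ((\<Psi> s 0 - \<Psi> r 0) /\<^sub>R (s - r)) ** \<Psi> 0 r)) \<longlongrightarrow>
      - (\<Psi> T r ** (L r ** \<Psi> r 0) ** \<Psi> 0 r)) (at r)"
    by (intro tendsto_minus mm.tendsto tendsto_const)
  moreover have "\<Psi> T r ** (L r ** \<Psi> r 0) ** \<Psi> 0 r = \<Psi> T r ** L r"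
    by (metis matrix_mul_assoc matrix_mul_rid psi_inverse)
  moreover have "- (\<Psi> T s ** ((\<Psi> s 0 - \<Psi> r 0) /\<^sub>R (s - r)) ** \<Psi> 0 r) = (\<Psi> T s - \<Psi> T r) /\<^sub>R (s - r)" for s
    unfolding psi_diff[of T s r 0] by (simp add: mm.scaleR_right mm.scaleR_left)
  ultimately show ?case unfolding has_vector_derivative_iff_quotient by simp
qed

end

section \<open>Controls and their integrals over the past and over finite intervals\<close>

lemma controls_iff:
  "\<xi> \<in> controls \<longleftrightarrow> \<xi> \<in> borel_measurable lebesgue \<and> (AE t in lebesgue. norm (\<xi> t) \<le> 1)"
proof -
  have "(AE t in lebesgue. norm (\<xi> t) \<le> 1)" if "\<xi> \<in> borel_measurable lebesgue"
      "esssup lebesgue (\<lambda>t. ereal (norm (\<xi> t))) \<le> 1"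
    using esssup_AE[of "\<lambda>t. ereal (norm (\<xi> t))" lebesgue]
  proof eventually_elim
    case (elim t)
    then have "ereal (norm (\<xi> t)) \<le> 1" using that(2) by (rule order_trans)
    then show ?case by (simp add: one_ereal_def)
  qed
  moreover have "esssup lebesgue (\<lambda>t. ereal (norm (\<xi> t))) \<le> 1"
    if "\<xi> \<in> borel_measurable lebesgue" "AE t in lebesgue. norm (\<xi> t) \<le> 1"
    by (rule esssup_I) (use that in \<open>auto simp: one_ereal_def\<close>)
  ultimately show ?thesis unfolding controls_def by blast
qed

text \<open>The substitution u = t - s leads to the half-line from 0. It is carried out for
  \<open>lborel\<close>; the integrand is Borel, so completing the measure changes nothing.\<close>

lemma exp_decay_past:
  fixes \<gamma> t :: real
  assumes "\<gamma> > 0"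
  shows "set_integrable lebesgue {..t} (\<lambda>s. exp (- \<gamma> * (t - s)))"
    and "(LINT s:{..t}|lebesgue. exp (- \<gamma> * (t - s))) = 1 / \<gamma>"
proof -
  define f where "f u = indicator {0..} u *\<^sub>R exp (- \<gamma> * u)" for u :: real
  have h: "((\<lambda>x. exp (- \<gamma> * x)) has_integral 1 / \<gamma>) {0..}"
    using has_integral_exp_minus_to_infinity[OF assms, of 0] by simp
  then have "(\<lambda>x. exp (- \<gamma> * x)) absolutely_integrable_on {0..}"
    by (intro nonnegative_absolutely_integrable_1) (auto simp: has_integral_integrable)
  then have i: "integrable lebesgue f" "(LINT u|lebesgue. f u) = 1 / \<gamma>"
    using set_lebesgue_integral_eq_integral(2)[of "{0..}" "\<lambda>x. exp (- \<gamma> * x)"] integral_unique[OF h]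
    by (simp_all add: set_integrable_def set_lebesgue_integral_def f_def[abs_def])
  have fm: "f \<in> borel_measurable lborel" unfolding f_def by measurable
  have j: "integrable lborel f" "(LINT u|lborel. f u) = 1 / \<gamma>"
    using i integrable_completion[OF fm] integral_completion[OF fm] by simp_all
  have e: "f (t + - 1 * s) = indicator {..t} s *\<^sub>R exp (- \<gamma> * (t - s))" for s
    by (auto simp: f_def indicator_def)
  have gm: "(\<lambda>s. f (t + - 1 * s)) \<in> borel_measurable lborel" using fm by measurable
  have "integrable lborel (\<lambda>s. f (t + - 1 * s))" using lborel_integrable_real_affine[OF j(1), of "- 1" t] by simp
  then show "set_integrable lebesgue {..t} (\<lambda>s. exp (- \<gamma> * (t - s)))"
    using integrable_completion[OF gm] unfolding e set_integrable_def by simp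
  have "(LINT s|lborel. f (t + - 1 * s)) = 1 / \<gamma>"
    using lborel_integral_real_affine[of "- 1" f t] j(2) by simp
  then show "(LINT s:{..t}|lebesgue. exp (- \<gamma> * (t - s))) = 1 / \<gamma>"
    using integral_completion[OF gm] unfolding e set_lebesgue_integral_def by simp
qed

context stable_linear_system
begin

lemma psi_measurable: "\<Psi> T \<in> borel_measurable lebesgue"
proof -
  have "\<Psi> T \<in> borel_measurable lborel"
    using borel_measurable_continuous_onI[OF psi_continuous_right[of UNIV T]] by simp
  then show ?thesis by (rule measurable_completion)
qed

lemma integrand_measurable:
  assumes "\<xi> \<in> borel_measurable lebesgue"
  shows "(\<lambda>s. \<Psi> T s *v \<xi> s) \<in> borel_measurable lebesgue"
  by (rule borel_measurable_continuous_Pair[OF psi_measurable assms])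
    (intro bounded_bilinear.continuous_on[OF bounded_bilinear_matrix_vector_mult] continuous_intros)

lemma integrand_bound:
  assumes "\<xi> \<in> controls"
  shows "AE s in lebesgue. s \<in> {..t} \<longrightarrow> norm (\<Psi> t s *v \<xi> s) \<le> \<kappa> * exp (- \<gamma> * (t - s))"
proof -
  have "AE s in lebesgue. norm (\<xi> s) \<le> 1" using assms by (simp add: controls_iff)
  then show ?thesis
  proof eventually_elim
    case (elim s)
    show ?case
    proof
      assume "s \<in> {..t}"
      then have "norm (\<Psi> t s *v \<xi> s) \<le> \<kappa> * exp (- \<gamma> * (t - s)) * norm (\<xi> s)" by (intro norm_psi_vec) simp
      also have "\<dots> \<le> \<kappa> * exp (- \<gamma> * (t - s)) * 1" using elim kappa by (intro mult_left_mono) auto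
      finally show "norm (\<Psi> t s *v \<xi> s) \<le> \<kappa> * exp (- \<gamma> * (t - s))" by simp
    qed
  qed
qed

lemma decay_integrable: "set_integrable lebesgue {..t} (\<lambda>s. \<kappa> * exp (- \<gamma> * (t - s)))"
  using exp_decay_past(1)[OF gamma] by (intro set_integrable_mult_right)

lemma integrand_integrable_past:
  assumes "\<xi> \<in> controls"
  shows "set_integrable lebesgue {..t} (\<lambda>s. \<Psi> t s *v \<xi> s)"
proof (rule set_integrable_bound[OF decay_integrable])
  show "set_borel_measurable lebesgue {..t} (\<lambda>s. \<Psi> t s *v \<xi> s)"
    unfolding set_borel_measurable_def
    by (intro borel_measurable_scaleR integrand_measurable borel_measurable_indicator)
      (use assms in \<open>auto simp: controls_iff\<close>)
  show "AE s in lebesgue. s \<in> {..t} \<longrightarrow> norm (\<Psi> t s *v \<xi> s) \<le> norm (\<kappa> * exp (- \<gamma> * (t - s)))"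
    using integrand_bound[OF assms] by eventually_elim force
qed

text \<open>Stability controls \<open>\<Psi> T s\<close> only for \<open>s \<le> T\<close>, and
  \<open>T\<close> may lie anywhere. Hence integrability is taken at time \<open>b\<close> and
  carried to \<open>T\<close> by the linear map \<open>\<Psi> T b\<close>.\<close>

lemma integrand_integrable:
  assumes "\<xi> \<in> controls"
  shows "(\<lambda>s. \<Psi> T s *v \<xi> s) absolutely_integrable_on {a..b}"
proof -
  have "(\<lambda>s. \<Psi> b s *v \<xi> s) absolutely_integrable_on {a..b}"
    by (rule set_integrable_subset[OF integrand_integrable_past[OF assms]]) auto
  from absolutely_integrable_linear[OF this matrix_vector_mul_bounded_linear[of "\<Psi> T b"]]
  show ?thesis by (simp add: o_def psi_cocycle_vec)
qed

lemma integrand_bounded: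
  assumes "\<xi> \<in> controls"
  shows "\<exists>C. AE s in lebesgue. s \<in> {a..b} \<longrightarrow> norm (\<Psi> T s *v \<xi> s) \<le> C"
proof -
  obtain K where K: "K > 0" "\<And>(A::real^'n^'n) (x::real^'n). norm (A *v x) \<le> norm A * norm x * K"
    using bounded_bilinear.pos_bounded[OF bounded_bilinear_matrix_vector_mult[where 'n='n and 'm='n]] by blast
  obtain B where B: "B > 0" "\<And>s. s \<le> b \<Longrightarrow> norm (\<Psi> T s) \<le> B" using psi_bounded_past by metis
  have "AE s in lebesgue. norm (\<xi> s) \<le> 1" using assms by (simp add: controls_iff)
  then have "AE s in lebesgue. s \<in> {a..b} \<longrightarrow> norm (\<Psi> T s *v \<xi> s) \<le> B * 1 * K"
  proof eventually_elim
    case (elim s)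
    show ?case
    proof
      assume "s \<in> {a..b}"
      then have "norm (\<Psi> T s) * norm (\<xi> s) * K \<le> B * 1 * K"
        using B elim K(1) by (intro mult_right_mono mult_mono) auto
      then show "norm (\<Psi> T s *v \<xi> s) \<le> B * 1 * K" using K(2) order_trans by blast
    qed
  qed
  then show ?thesis by blast
qed

text \<open>For \<rho> = 1 this is the value at \<open>t\<close> of the solution driven by
  \<open>\<xi>\<close> that stays bounded on the whole line.\<close>

definition response :: "real \<Rightarrow> (real \<Rightarrow> real^'n) \<Rightarrow> real^'n" where
  "response t \<xi> = (LINT s:{..t}|lebesgue. \<Psi> t s *v \<xi> s)"

text \<open>The forced part of variation of constants: the state reached from 0 for \<rho> =
  1.\<close>

definition reach :: "real \<Rightarrow> real \<Rightarrow> (real \<Rightarrow> real^'n) \<Rightarrow> real^'n" where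
  "reach t\<^sub>0 t \<xi> = (LINT s:{t\<^sub>0..t}|lebesgue. \<Psi> t s *v \<xi> s)"

lemma reach_eq_integral: "\<xi> \<in> controls \<Longrightarrow> reach t\<^sub>0 t \<xi> = integral {t\<^sub>0..t} (\<lambda>s. \<Psi> t s *v \<xi> s)"
  unfolding reach_def by (rule set_lebesgue_integral_eq_integral(2)[OF integrand_integrable])

lemma norm_response:
  assumes "\<xi> \<in> controls"
  shows "norm (response t \<xi>) \<le> \<kappa> / \<gamma>"
proof -
  have "norm (response t \<xi>) \<le> (LINT s:{..t}|lebesgue. \<kappa> * exp (- \<gamma> * (t - s)))"
    unfolding response_def set_lebesgue_integral_def
  proof (rule order_trans[OF integral_norm_bound], rule integral_mono_AE)
    show "integrable lebesgue (\<lambda>s. norm (indicator {..t} s *\<^sub>R (\<Psi> t s *v \<xi> s)))"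
      using integrand_integrable_past[OF assms, of t] unfolding set_integrable_def by (rule integrable_norm)
    show "integrable lebesgue (\<lambda>s. indicator {..t} s *\<^sub>R (\<kappa> * exp (- \<gamma> * (t - s))))"
      using decay_integrable[of t] unfolding set_integrable_def .
    show "AE s in lebesgue. norm (indicator {..t} s *\<^sub>R (\<Psi> t s *v \<xi> s)) \<le> indicator {..t} s *\<^sub>R (\<kappa> * exp (- \<gamma> * (t - s)))"
      using integrand_bound[OF assms, of t] by eventually_elim (simp add: indicator_def)
  qed
  also have "\<dots> = \<kappa> / \<gamma>" using exp_decay_past(2)[OF gamma, of t] by simp
  finally show ?thesis .
qed

text \<open>The response is itself a trajectory: this is variation of constants started at
  \<open>response t\<^sub>0 \<xi>\<close>. The past part factors because
  \<open>\<Psi> t s = \<Psi> t t\<^sub>0 ** \<Psi> t\<^sub>0 s\<close>.\<close>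

lemma response_split:
  assumes "\<xi> \<in> controls" "t\<^sub>0 \<le> t"
  shows "response t \<xi> = \<Psi> t t\<^sub>0 *v response t\<^sub>0 \<xi> + reach t\<^sub>0 t \<xi>"
proof -
  have int: "set_integrable lebesgue {..t\<^sub>0} (\<lambda>s. \<Psi> t s *v \<xi> s)"
    by (rule set_integrable_subset[OF integrand_integrable_past[OF assms(1), of t]]) (use assms(2) in auto)
  \<comment> \<open>Both pieces of the domain contain the cut point, so they are disjoint only up to
    a null set.\<close>
  have "AE s in lebesgue. s \<noteq> t\<^sub>0"
    using AE_not_in[of "{t\<^sub>0}" lebesgue] by (simp add: negligible_iff_null_sets[symmetric])
  then have AE: "AE s in lebesgue. \<not> (s \<in> {..t\<^sub>0} \<and> s \<in> {t\<^sub>0..t})" by eventually_elim auto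
  have "response t \<xi> = (LINT s:{..t\<^sub>0} \<union> {t\<^sub>0..t}|lebesgue. \<Psi> t s *v \<xi> s)"
    unfolding response_def using assms(2) by (intro arg_cong2[where f = "\<lambda>A. set_lebesgue_integral lebesgue A"]) auto
  also have "\<dots> = (LINT s:{..t\<^sub>0}|lebesgue. \<Psi> t s *v \<xi> s) + reach t\<^sub>0 t \<xi>"
    unfolding reach_def by (rule set_integral_Un_AE[OF AE _ _ int integrand_integrable[OF assms(1)]]) simp_all
  also have "(LINT s:{..t\<^sub>0}|lebesgue. \<Psi> t s *v \<xi> s) = \<Psi> t t\<^sub>0 *v response t\<^sub>0 \<xi>"
  proof -
    have "(LINT s|lebesgue. \<Psi> t t\<^sub>0 *v (indicator {..t\<^sub>0} s *\<^sub>R (\<Psi> t\<^sub>0 s *v \<xi> s)))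
        = \<Psi> t t\<^sub>0 *v (LINT s|lebesgue. indicator {..t\<^sub>0} s *\<^sub>R (\<Psi> t\<^sub>0 s *v \<xi> s))"
      by (rule integral_bounded_linear[OF matrix_vector_mul_bounded_linear])
        (use integrand_integrable_past[OF assms(1), of t\<^sub>0] in \<open>simp add: set_integrable_def\<close>)
    then show ?thesis
      by (simp add: response_def set_lebesgue_integral_def matrix_vector_mult_scaleR psi_cocycle_vec)
  qed
  finally show ?thesis .
qed

text \<open>Past and future can be prescribed independently, since \<open>response\<close> at the
  cut sees only earlier times and \<open>reach\<close> only later ones; the shared instant is
  null.\<close>

lemma concatenate_controls:
  fixes \<xi>\<^sub>1 \<xi>\<^sub>2 :: "real \<Rightarrow> real^'n"
  assumes "\<xi>\<^sub>1 \<in> controls" "\<xi>\<^sub>2 \<in> controls"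
  obtains \<xi> where "\<xi> \<in> controls" "response t\<^sub>0 \<xi> = response t\<^sub>0 \<xi>\<^sub>1" "reach t\<^sub>0 t \<xi> = reach t\<^sub>0 t \<xi>\<^sub>2"
proof -
  define \<xi> where "\<xi> s = (if s \<in> {..t\<^sub>0} then \<xi>\<^sub>1 s else \<xi>\<^sub>2 s)" for s
  have m: "\<xi>\<^sub>1 \<in> borel_measurable lebesgue" "\<xi>\<^sub>2 \<in> borel_measurable lebesgue"
    and b: "AE s in lebesgue. norm (\<xi>\<^sub>1 s) \<le> 1" "AE s in lebesgue. norm (\<xi>\<^sub>2 s) \<le> 1"
    using assms by (auto simp: controls_iff)
  have "\<xi> \<in> borel_measurable lebesgue"
    unfolding \<xi>_def by (rule measurable_If_set[OF m]) simp
  moreover have "AE s in lebesgue. norm (\<xi> s) \<le> 1"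
    using b by eventually_elim (simp add: \<xi>_def)
  ultimately have c: "\<xi> \<in> controls" by (simp add: controls_iff)
  moreover have "response t\<^sub>0 \<xi> = response t\<^sub>0 \<xi>\<^sub>1"
    unfolding response_def by (rule set_lebesgue_integral_cong) (auto simp: \<xi>_def)
  moreover have "reach t\<^sub>0 t \<xi> = reach t\<^sub>0 t \<xi>\<^sub>2"
    unfolding reach_eq_integral[OF c] reach_eq_integral[OF assms(2)]
    by (rule integral_spike[of "{t\<^sub>0}"]) (auto simp: \<xi>_def)
  ultimately show ?thesis by (rule that)
qed

subsection \<open>Variation of constants\<close>

text \<open>Differentiate \<open>\<Psi> t s *v x s\<close> in \<open>s\<close>: by the adjoint
  equation the terms with \<open>L s\<close> cancel, and only the forcing term is left to
  integrate.\<close>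

lemma solution_endpoint:
  assumes t: "t\<^sub>0 \<le> t" and \<xi>: "\<xi> \<in> controls"
    and sol: "caratheodory_solution {t\<^sub>0..t} (\<lambda>s y. L s *v y + \<rho> *\<^sub>R \<xi> s) x"
  shows "x t = \<Psi> t t\<^sub>0 *v x t\<^sub>0 + \<rho> *\<^sub>R reach t\<^sub>0 t \<xi>"
proof -
  interpret mv: bounded_bilinear "(*v) :: real^'n^'n \<Rightarrow> real^'n \<Rightarrow> real^'n"
    by (rule bounded_bilinear_matrix_vector_mult)
  have AC: "absolutely_continuous_on {t\<^sub>0..t} x"
    and der: "AE s in lebesgue. s \<in> {t\<^sub>0..t} \<longrightarrow>
      (x has_vector_derivative L s *v x s + \<rho> *\<^sub>R \<xi> s) (at s within {t\<^sub>0..t})"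
    using sol unfolding caratheodory_solution_def by auto
  have "((\<lambda>s. \<rho> *\<^sub>R (\<Psi> t s *v \<xi> s)) has_integral (\<Psi> t t *v x t - \<Psi> t t\<^sub>0 *v x t\<^sub>0)) {t\<^sub>0..t}"
  proof (rule absolutely_continuous_on_has_integral[OF t])
    show "absolutely_continuous_on {t\<^sub>0..t} (\<lambda>s. \<Psi> t s *v x s)"
      by (rule absolutely_continuous_on_bilinear[OF bounded_bilinear_matrix_vector_mult
            psi_absolutely_continuous_right AC])
    show "AE s in lebesgue. s \<in> {t\<^sub>0..t} \<longrightarrow>
        ((\<lambda>s. \<Psi> t s *v x s) has_vector_derivative \<rho> *\<^sub>R (\<Psi> t s *v \<xi> s)) (at s within {t\<^sub>0..t})"
      using der psi_derivative_right[of t]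
    proof eventually_elim
      case (elim s)
      show ?case
      proof
        assume s: "s \<in> {t\<^sub>0..t}"
        have "((\<lambda>s. \<Psi> t s *v x s) has_vector_derivative
            \<Psi> t s *v (L s *v x s + \<rho> *\<^sub>R \<xi> s) + - (\<Psi> t s ** L s) *v x s) (at s within {t\<^sub>0..t})"
          using elim(1) s by (intro mv.has_vector_derivative has_vector_derivative_at_within[OF elim(2)]) blast
        then show "((\<lambda>s. \<Psi> t s *v x s) has_vector_derivative \<rho> *\<^sub>R (\<Psi> t s *v \<xi> s)) (at s within {t\<^sub>0..t})"
          by (simp add: mv.add_right mv.scaleR_right mv.minus_left matrix_vector_mul_assoc)
      qed
    qed
  qed
  moreover have "((\<lambda>s. \<rho> *\<^sub>R (\<Psi> t s *v \<xi> s)) has_integral \<rho> *\<^sub>R reach t\<^sub>0 t \<xi>) {t\<^sub>0..t}"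
    unfolding reach_eq_integral[OF \<xi>]
    by (intro has_integral_cmul integrable_integral set_lebesgue_integral_eq_integral(1) integrand_integrable \<xi>)
  ultimately have "\<Psi> t t *v x t - \<Psi> t t\<^sub>0 *v x t\<^sub>0 = \<rho> *\<^sub>R reach t\<^sub>0 t \<xi>" by (rule has_integral_unique)
  then show ?thesis by (simp add: algebra_simps)
qed

text \<open>In the coordinates \<open>x u = \<Psi> u t\<^sub>0 *v y u\<close> the right-hand side no
  longer contains the state, so \<open>y\<close> is a plain integral and no fixed point argument is
  involved.\<close>

lemma solution_exists:
  assumes t: "t\<^sub>0 \<le> t" and \<xi>: "\<xi> \<in> controls"
  obtains x where "caratheodory_solution {t\<^sub>0..t} (\<lambda>s y. L s *v y + \<rho> *\<^sub>R \<xi> s) x" "x t\<^sub>0 = x\<^sub>0"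
proof -
  interpret mv: bounded_bilinear "(*v) :: real^'n^'n \<Rightarrow> real^'n \<Rightarrow> real^'n"
    by (rule bounded_bilinear_matrix_vector_mult)
  define y where "y u = x\<^sub>0 + \<rho> *\<^sub>R integral {t\<^sub>0..u} (\<lambda>s. \<Psi> t\<^sub>0 s *v \<xi> s)" for u
  define x where "x u = \<Psi> u t\<^sub>0 *v y u" for u
  note int = integrand_integrable[OF \<xi>, of t\<^sub>0 t t\<^sub>0]
  obtain C where C: "AE s in lebesgue. s \<in> {t\<^sub>0..t} \<longrightarrow> norm (\<Psi> t\<^sub>0 s *v \<xi> s) \<le> C"
    using integrand_bounded[OF \<xi>] by blast
  have yAC: "absolutely_continuous_on {t\<^sub>0..t} y"
    unfolding y_def
    by (rule absolutely_continuous_on_add[OF absolutely_continuous_on_const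
          absolutely_continuous_on_bilinear[OF bounded_bilinear_scaleR absolutely_continuous_on_const
            absolutely_continuous_on_integral[OF int C]]])
  have "absolutely_continuous_on {t\<^sub>0..t} x"
    unfolding x_def
    by (rule absolutely_continuous_on_bilinear[OF bounded_bilinear_matrix_vector_mult psi_absolutely_continuous yAC])
  moreover have "AE s in lebesgue. s \<in> {t\<^sub>0..t} \<longrightarrow>
      (x has_vector_derivative L s *v x s + \<rho> *\<^sub>R \<xi> s) (at s within {t\<^sub>0..t})"
    using integral_has_vector_derivative_AE[OF set_lebesgue_integral_eq_integral(1)[OF int]] psi_derivative[of t\<^sub>0]
  proof eventually_elim
    case (elim s)
    show ?case
    proof
      assume s: "s \<in> {t\<^sub>0..t}"
      have "(y has_vector_derivative 0 + \<rho> *\<^sub>R (\<Psi> t\<^sub>0 s *v \<xi> s)) (at s within {t\<^sub>0..t})"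
        unfolding y_def using elim(1) s
        by (intro has_vector_derivative_add has_vector_derivative_const
            bounded_linear.has_vector_derivative[OF bounded_linear_scaleR_right]) blast
      then have "(x has_vector_derivative \<Psi> s t\<^sub>0 *v (0 + \<rho> *\<^sub>R (\<Psi> t\<^sub>0 s *v \<xi> s)) + (L s ** \<Psi> s t\<^sub>0) *v y s)
          (at s within {t\<^sub>0..t})"
        unfolding x_def by (intro mv.has_vector_derivative has_vector_derivative_at_within[OF elim(2)])
      moreover have "\<Psi> s t\<^sub>0 *v (0 + \<rho> *\<^sub>R (\<Psi> t\<^sub>0 s *v \<xi> s)) + (L s ** \<Psi> s t\<^sub>0) *v y s = L s *v x s + \<rho> *\<^sub>R \<xi> s"
        by (simp add: mv.scaleR_right psi_cocycle_vec x_def matrix_vector_mul_assoc[symmetric])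
      ultimately show "(x has_vector_derivative L s *v x s + \<rho> *\<^sub>R \<xi> s) (at s within {t\<^sub>0..t})" by simp
    qed
  qed
  ultimately have "caratheodory_solution {t\<^sub>0..t} (\<lambda>s y. L s *v y + \<rho> *\<^sub>R \<xi> s) x"
    unfolding caratheodory_solution_def by (metis absolutely_continuous_on_subset)
  moreover have "x t\<^sub>0 = x\<^sub>0" by (simp add: x_def y_def)
  ultimately show ?thesis by (rule that)
qed

text \<open>From here on differential equations disappear: the flow is handled through this formula
  alone.\<close>

lemma mem_flow_iff:
  assumes "t\<^sub>0 < t"
  shows "z \<in> flow L \<rho> t t\<^sub>0 x\<^sub>0 \<longleftrightarrow> (\<exists>\<xi>\<in>controls. z = \<Psi> t t\<^sub>0 *v x\<^sub>0 + \<rho> *\<^sub>R reach t\<^sub>0 t \<xi>)"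
proof
  assume "z \<in> flow L \<rho> t t\<^sub>0 x\<^sub>0"
  then obtain x \<xi> where x: "z = x t" "\<xi> \<in> controls" "x t\<^sub>0 = x\<^sub>0"
    "caratheodory_solution {t\<^sub>0..t} (\<lambda>s y. L s *v y + \<rho> *\<^sub>R \<xi> s) x"
    unfolding flow_def by blast
  have "z = \<Psi> t t\<^sub>0 *v x\<^sub>0 + \<rho> *\<^sub>R reach t\<^sub>0 t \<xi>"
    using solution_endpoint[OF less_imp_le[OF assms] x(2,4)] x(1,3) by simp
  then show "\<exists>\<xi>\<in>controls. z = \<Psi> t t\<^sub>0 *v x\<^sub>0 + \<rho> *\<^sub>R reach t\<^sub>0 t \<xi>" by (intro bexI[of _ \<xi>] x(2))
next
  assume "\<exists>\<xi>\<in>controls. z = \<Psi> t t\<^sub>0 *v x\<^sub>0 + \<rho> *\<^sub>R reach t\<^sub>0 t \<xi>"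
  then obtain \<xi> where \<xi>: "\<xi> \<in> controls" "z = \<Psi> t t\<^sub>0 *v x\<^sub>0 + \<rho> *\<^sub>R reach t\<^sub>0 t \<xi>" by (rule bexE)
  obtain x where x: "caratheodory_solution {t\<^sub>0..t} (\<lambda>s y. L s *v y + \<rho> *\<^sub>R \<xi> s) x" "x t\<^sub>0 = x\<^sub>0"
    by (rule solution_exists[OF less_imp_le[OF assms] \<xi>(1), where \<rho> = \<rho> and x\<^sub>0 = x\<^sub>0])
  have "z = x t" using solution_endpoint[OF less_imp_le[OF assms] \<xi>(1) x(1)] x(2) \<xi>(2) by simp
  then show "z \<in> flow L \<rho> t t\<^sub>0 x\<^sub>0"
    unfolding flow_def mem_Collect_eq by (intro exI[of _ x] exI[of _ \<xi>] conjI \<xi>(1) x)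
qed

end

subsection \<open>Closedness of the attractor\<close>


context stable_linear_system
begin

lemma response_integrable:
  "\<xi> \<in> controls \<Longrightarrow> integrable lebesgue (\<lambda>s. indicator {..t} s *\<^sub>R (\<Psi> t s *v \<xi> s))"
  using integrand_integrable_past[of \<xi> t] by (simp add: set_integrable_def)

lemma convex_responses: "convex (response t ` controls)"
proof (rule convexI)
  fix x y and u v :: real
  assume xy: "x \<in> response t ` controls" "y \<in> response t ` controls" and uv: "0 \<le> u" "0 \<le> v" "u + v = 1"
  obtain \<xi> \<eta> where \<xi>: "\<xi> \<in> controls" "x = response t \<xi>" and \<eta>: "\<eta> \<in> controls" "y = response t \<eta>"
    using xy by (metis imageE)
  define \<zeta> where "\<zeta> s = u *\<^sub>R \<xi> s + v *\<^sub>R \<eta> s" for s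
  have m: "\<xi> \<in> borel_measurable lebesgue" "\<eta> \<in> borel_measurable lebesgue"
    and b: "AE s in lebesgue. norm (\<xi> s) \<le> 1" "AE s in lebesgue. norm (\<eta> s) \<le> 1"
    using \<xi>(1) \<eta>(1) by (auto simp: controls_iff)
  have "\<zeta> \<in> borel_measurable lebesgue"
    unfolding \<zeta>_def by (intro borel_measurable_add borel_measurable_scaleR borel_measurable_const m)
  moreover have "AE s in lebesgue. norm (\<zeta> s) \<le> 1"
    using b
  proof eventually_elim
    case (elim s)
    have "norm (\<zeta> s) \<le> u * norm (\<xi> s) + v * norm (\<eta> s)"
      unfolding \<zeta>_def using norm_triangle_ineq[of "u *\<^sub>R \<xi> s" "v *\<^sub>R \<eta> s"] uv by simp
    also have "\<dots> \<le> u * 1 + v * 1" using elim uv by (intro add_mono mult_left_mono) auto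
    finally show ?case using uv by simp
  qed
  ultimately have \<zeta>: "\<zeta> \<in> controls" by (simp add: controls_iff)
  have e: "indicator {..t} s *\<^sub>R (\<Psi> t s *v \<zeta> s) =
      u *\<^sub>R (indicator {..t} s *\<^sub>R (\<Psi> t s *v \<xi> s)) + v *\<^sub>R (indicator {..t} s *\<^sub>R (\<Psi> t s *v \<eta> s))" for s
    by (simp add: \<zeta>_def matrix_vector_right_distrib matrix_vector_mult_scaleR scaleR_add_right mult.commute)
  have "response t \<zeta> = u *\<^sub>R x + v *\<^sub>R y"
    unfolding response_def set_lebesgue_integral_def e \<xi>(2) \<eta>(2)
    using response_integrable[OF \<xi>(1), of t] response_integrable[OF \<eta>(1), of t]
    by (simp del: scaleR_scaleR)
  then show "u *\<^sub>R x + v *\<^sub>R y \<in> response t ` controls" using \<zeta> by (metis imageI)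
qed

lemma zero_control: "(\<lambda>s. 0) \<in> controls"
  by (simp add: controls_iff)

lemma adjoint_inner: "p \<bullet> (\<Psi> t s *v x) = (p v* \<Psi> t s) \<bullet> x"
  by (simp add: dot_lmul_matrix)

text \<open>Pairing \<open>p v* \<Psi> t s\<close> with \<open>\<Psi> s t *v p\<close> gives
  \<open>p \<bullet> p\<close>. Nonvanishing is what singles out one maximising control.\<close>

lemma adjoint_nonzero: "p \<noteq> 0 \<Longrightarrow> p v* \<Psi> t s \<noteq> 0"
proof
  assume "p \<noteq> 0" "p v* \<Psi> t s = 0"
  then have "p \<bullet> (\<Psi> t s *v (\<Psi> s t *v p)) = 0" by (simp add: adjoint_inner)
  then show False using \<open>p \<noteq> 0\<close> by (simp add: psi_cocycle_vec)
qed

lemma adjoint_measurable: "(\<lambda>s. p v* \<Psi> t s) \<in> borel_measurable lebesgue"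
proof -
  have "linear (\<lambda>A::real^'n^'n. p v* A)"
    by (intro linearI) (simp_all add: vec_eq_iff vector_matrix_mult_def algebra_simps sum.distrib sum_distrib_left)
  then have "continuous_on UNIV (\<lambda>A::real^'n^'n. p v* A)" by (rule linear_continuous_on[OF linear_conv_bounded_linear[THEN iffD1]])
  then have "(\<lambda>A::real^'n^'n. p v* A) \<in> borel_measurable borel" by (rule borel_measurable_continuous_onI)
  from measurable_compose[OF psi_measurable this] show ?thesis .
qed

text \<open>The equality case of Cauchy-Schwarz: the control that Pontryagin's principle prescribes
  for the functional \<open>p\<close>. Since \<open>sgn\<close> sends 0 to 0, it is a control for
  \<open>p = 0\<close> as well.\<close>

definition extremal :: "real \<Rightarrow> real^'n \<Rightarrow> real \<Rightarrow> real^'n" where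
  "extremal t p s = sgn (p v* \<Psi> t s)"

lemma norm_extremal: "p \<noteq> 0 \<Longrightarrow> norm (extremal t p s) = 1"
  using adjoint_nonzero[of p t s] by (simp add: extremal_def norm_sgn)

lemma extremal_control: "extremal t p \<in> controls"
proof -
  have "extremal t p \<in> borel_measurable lebesgue"
    unfolding extremal_def sgn_div_norm using adjoint_measurable[of p t] by measurable
  then show ?thesis by (simp add: controls_iff extremal_def norm_sgn)
qed

lemma inner_response:
  assumes "\<xi> \<in> controls"
  shows "integrable lebesgue (\<lambda>s. indicator {..t} s *\<^sub>R ((p v* \<Psi> t s) \<bullet> \<xi> s))"
    and "p \<bullet> response t \<xi> = (LINT s|lebesgue. indicator {..t} s *\<^sub>R ((p v* \<Psi> t s) \<bullet> \<xi> s))"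
proof -
  have e: "indicator {..t} s *\<^sub>R ((p v* \<Psi> t s) \<bullet> \<xi> s) = p \<bullet> (indicator {..t} s *\<^sub>R (\<Psi> t s *v \<xi> s))" for s
    by (simp add: adjoint_inner)
  show "integrable lebesgue (\<lambda>s. indicator {..t} s *\<^sub>R ((p v* \<Psi> t s) \<bullet> \<xi> s))"
    unfolding e using response_integrable[OF assms, of t] by (rule integrable_inner_right)
  show "p \<bullet> response t \<xi> = (LINT s|lebesgue. indicator {..t} s *\<^sub>R ((p v* \<Psi> t s) \<bullet> \<xi> s))"
    unfolding e response_def set_lebesgue_integral_def
    by (rule integral_inner_right[symmetric]) (rule response_integrable[OF assms])
qed

lemma extremal_limit:
  assumes \<xi>: "\<And>n. \<xi> n \<in> controls" and lim: "(\<lambda>n. response t (\<xi> n)) \<longlonglongrightarrow> z"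
    and p: "p \<noteq> 0" and max: "\<And>\<eta>. \<eta> \<in> controls \<Longrightarrow> p \<bullet> response t \<eta> \<le> p \<bullet> z"
  shows "z = response t (extremal t p)"
proof -
  let ?g = "\<lambda>s. p v* \<Psi> t s" and ?e = "extremal t p"
  have ge: "?g s = norm (?g s) *\<^sub>R ?e s" for s
    by (cases "?g s = 0") (simp_all add: extremal_def sgn_div_norm)
  have gee: "?g s \<bullet> ?e s = norm (?g s)" for s
    using norm_extremal[OF p, of t s] by (subst ge) (simp add: norm_eq_1)
  have \<xi>1: "AE s in lebesgue. norm (\<xi> n s) \<le> 1" for n using \<xi>[of n] by (simp add: controls_iff)
  \<comment> \<open>The pointwise loss of \<open>\<xi> n\<close> against the extremal control,
    nonnegative a.e. by Cauchy-Schwarz.\<close>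
  define u where "u n s = indicator {..t} s *\<^sub>R (?g s \<bullet> ?e s) - indicator {..t} s *\<^sub>R (?g s \<bullet> \<xi> n s)" for n s
  have ui: "integrable lebesgue (u n)" for n
    unfolding u_def by (intro Bochner_Integration.integrable_diff inner_response(1) extremal_control \<xi>)
  have uint: "(LINT s|lebesgue. u n s) = p \<bullet> response t ?e - p \<bullet> response t (\<xi> n)" for n
    unfolding u_def inner_response(2)[OF extremal_control] inner_response(2)[OF \<xi>]
    by (intro Bochner_Integration.integral_diff inner_response(1) extremal_control \<xi>)
  have u0: "AE s in lebesgue. 0 \<le> u n s" for n
    using \<xi>1[of n]
  proof eventually_elim
    case (elim s)
    have "?g s \<bullet> \<xi> n s \<le> norm (?g s) * norm (\<xi> n s)" by (rule norm_cauchy_schwarz)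
    also have "\<dots> \<le> norm (?g s) * 1" using elim by (intro mult_left_mono) auto
    finally show ?case by (simp add: u_def gee indicator_def)
  qed
  have unorm: "(LINT s|lebesgue. norm (u n s)) = (LINT s|lebesgue. u n s)" for n
  proof (rule integral_cong_AE)
    show "AE s in lebesgue. norm (u n s) = u n s" using u0[of n] by eventually_elim simp
  qed (use borel_measurable_integrable[OF ui[of n]] in auto)
  have "(\<lambda>n. LINT s|lebesgue. norm (u n s)) \<longlonglongrightarrow> p \<bullet> response t ?e - p \<bullet> z"
    unfolding unorm uint by (intro tendsto_intros lim)
  \<comment> \<open>The extremal control is itself a competitor in \<open>max\<close>, and a limit
    of nonnegative integrals is nonnegative; together they force the mean loss to 0.\<close>
  moreover have "p \<bullet> response t ?e - p \<bullet> z = 0"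
  proof (rule antisym)
    show "p \<bullet> response t ?e - p \<bullet> z \<le> 0" using max[OF extremal_control] by simp
    show "0 \<le> p \<bullet> response t ?e - p \<bullet> z"
      using calculation by (rule LIMSEQ_le_const) simp
  qed
  ultimately have "(\<lambda>n. LINT s|lebesgue. norm (u n s)) \<longlonglongrightarrow> 0" by simp
  from tendsto_L1_AE_subseq[OF ui this] obtain r where r: "strict_mono r"
    "AE s in lebesgue. (\<lambda>n. u (r n) s) \<longlonglongrightarrow> 0" by blast
  have \<xi>all: "AE s in lebesgue. \<forall>n. norm (\<xi> n s) \<le> 1" using \<xi>1 by (simp add: AE_all_countable)
  have ptw: "AE s in lebesgue. (\<lambda>n. indicator {..t} s *\<^sub>R (\<Psi> t s *v \<xi> (r n) s)) \<longlonglongrightarrow> indicator {..t} s *\<^sub>R (\<Psi> t s *v ?e s)"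
    using r(2) \<xi>all
  proof eventually_elim
    case (elim s)
    show ?case
    proof (cases "s \<le> t")
      case True
      have g0: "norm (?g s) > 0" using adjoint_nonzero[OF p] by simp
      have "u n s = norm (?g s) * (1 - ?e s \<bullet> \<xi> n s)" for n
      proof -
        have "?g s \<bullet> \<xi> n s = norm (?g s) * (?e s \<bullet> \<xi> n s)" by (subst ge) simp
        then show ?thesis using True by (simp add: u_def gee right_diff_distrib)
      qed
      then have "(\<lambda>n. inverse (norm (?g s)) * (norm (?g s) * (1 - ?e s \<bullet> \<xi> (r n) s))) \<longlonglongrightarrow> inverse (norm (?g s)) * 0"
        using elim(1) by (intro tendsto_mult_left) simp
      then have "(\<lambda>n. 1 - ?e s \<bullet> \<xi> (r n) s) \<longlonglongrightarrow> 0" using g0 by (simp add: mult.assoc[symmetric])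
      then have l: "(\<lambda>n. 2 * (1 - ?e s \<bullet> \<xi> (r n) s)) \<longlonglongrightarrow> 0" using tendsto_mult_left[of _ 0 _ 2] by fastforce
      \<comment> \<open>Strict convexity of the ball in quantitative form: expand the square and use
        that \<open>?e s\<close> is a unit vector.\<close>
      have "(norm (\<xi> n s - ?e s))\<^sup>2 \<le> 2 * (1 - ?e s \<bullet> \<xi> n s)" for n
      proof -
        have "(norm (\<xi> n s - ?e s))\<^sup>2 = (norm (\<xi> n s))\<^sup>2 + (norm (?e s))\<^sup>2 - 2 * (?e s \<bullet> \<xi> n s)"
          by (simp add: power2_norm_eq_inner inner_diff_left inner_diff_right inner_commute)
        moreover have "(norm (\<xi> n s))\<^sup>2 \<le> 1" using elim(2) by (simp add: power_le_one)
        ultimately show ?thesis using norm_extremal[OF p, of t s] by simp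
      qed
      then have "(\<lambda>n. (norm (\<xi> (r n) s - ?e s))\<^sup>2) \<longlonglongrightarrow> 0"
        by (intro tendsto_sandwich[OF _ _ tendsto_const l]) auto
      then have "(\<lambda>n. \<xi> (r n) s) \<longlonglongrightarrow> ?e s" by (simp add: LIM_zero_iff tendsto_norm_zero_iff)
      then show ?thesis
        by (intro tendsto_scaleR tendsto_const bounded_linear.tendsto[OF matrix_vector_mul_bounded_linear])
    qed simp
  qed
  have "(\<lambda>n. LINT s|lebesgue. indicator {..t} s *\<^sub>R (\<Psi> t s *v \<xi> (r n) s)) \<longlonglongrightarrow>
      (LINT s|lebesgue. indicator {..t} s *\<^sub>R (\<Psi> t s *v ?e s))"
  proof (rule integral_dominated_convergence[OF _ _ _ ptw])
    show "integrable lebesgue (\<lambda>s. indicator {..t} s *\<^sub>R (\<kappa> * exp (- \<gamma> * (t - s))))"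
      using decay_integrable[of t] unfolding set_integrable_def .
    show "AE s in lebesgue. norm (indicator {..t} s *\<^sub>R (\<Psi> t s *v \<xi> (r n) s)) \<le> indicator {..t} s *\<^sub>R (\<kappa> * exp (- \<gamma> * (t - s)))" for n
      using integrand_bound[OF \<xi>, of t "r n"] by eventually_elim (simp add: indicator_def)
  qed (use borel_measurable_integrable[OF response_integrable] extremal_control \<xi> in blast)+
  then have "(\<lambda>n. response t (\<xi> (r n))) \<longlonglongrightarrow> response t ?e"
    by (simp add: response_def set_lebesgue_integral_def)
  moreover have "(\<lambda>n. response t (\<xi> (r n))) \<longlonglongrightarrow> z"
    using LIMSEQ_subseq_LIMSEQ[OF lim r(1)] by (simp add: o_def)
  ultimately show ?thesis using LIMSEQ_unique by blast
qed

lemma closed_responses: "closed (response t ` controls)"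
proof -
  have "z \<in> response t ` controls" if z: "z \<in> closure (response t ` controls)" for z
  proof (rule ccontr)
    assume nz: "z \<notin> response t ` controls"
    have "response t ` controls \<noteq> {}" using zero_control by blast
    moreover have "{z} \<inter> response t ` controls = {}" using nz by simp
    \<comment> \<open>A point of the closure cannot be separated strictly. Weak separation suffices,
      because \<open>extremal_limit\<close> treats exactly a supporting hyperplane.\<close>
    ultimately obtain a b where ab: "a \<noteq> 0" "a \<bullet> z \<le> b" "\<And>w. w \<in> response t ` controls \<Longrightarrow> b \<le> a \<bullet> w"
      using separating_hyperplane_sets[OF convex_singleton convex_responses[of t], of z] by auto
    obtain f where f: "\<And>n. f n \<in> response t ` controls" "f \<longlonglongrightarrow> z"
      using z unfolding closure_sequential by blast
    have "\<exists>\<xi>. \<xi> \<in> controls \<and> f n = response t \<xi>" for n using f(1)[of n] by (elim imageE) blast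
    then have "\<exists>\<xi>. \<forall>n. \<xi> n \<in> controls \<and> f n = response t (\<xi> n)" by (intro choice allI)
    then obtain \<xi> where \<xi>': "\<forall>n. \<xi> n \<in> controls \<and> f n = response t (\<xi> n)" by (elim exE)
    have \<xi>: "\<xi> n \<in> controls" "f n = response t (\<xi> n)" for n using \<xi>' by simp_all
    \<comment> \<open>The responses lie on the upper side of the hyperplane, so \<open>z\<close>
      maximises the functional of \<open>- a\<close>.\<close>
    have "z = response t (extremal t (- a))"
    proof (rule extremal_limit[where \<xi> = \<xi>])
      show "(\<lambda>n. response t (\<xi> n)) \<longlonglongrightarrow> z" using f(2) by (simp add: \<xi>(2)[symmetric])
      show "- a \<bullet> response t \<eta> \<le> - a \<bullet> z" if "\<eta> \<in> controls" for \<eta>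
        using ab(2) ab(3)[of "response t \<eta>"] that by force
    qed (use ab(1) \<xi>(1) in auto)
    then show False using nz extremal_control by blast
  qed
  then show ?thesis by (meson closure_subset_eq subsetI)
qed

end

subsection \<open>Invariance and attraction\<close>

lemma semidist_le:
  fixes A B :: "'a::metric_space set"
  assumes "\<And>x. x \<in> A \<Longrightarrow> \<exists>y\<in>B. dist x y \<le> c"
  shows "semidist A B \<le> ereal c"
  unfolding semidist_def
proof (rule SUP_least)
  fix x assume "x \<in> A"
  then obtain y where "y \<in> B" "dist x y \<le> c" using assms by blast
  then show "(INF y\<in>B. ereal (dist x y)) \<le> ereal c" by (intro INF_lower2[of y]) auto
qed

text \<open>Over an empty first set the supremum would be minus infinity, so the lower half of the
  later squeeze needs a point.\<close>

lemma semidist_nonneg: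
  fixes A B :: "'a::metric_space set"
  assumes "A \<noteq> {}"
  shows "0 \<le> semidist A B"
proof -
  obtain x where "x \<in> A" using assms by blast
  then show ?thesis unfolding semidist_def by (intro SUP_upper2[of x] INF_greatest) auto
qed

context stable_linear_system
begin

lemma mem_attractor_iff: "z \<in> attractor \<rho> \<Psi> t \<longleftrightarrow> (\<exists>\<xi>\<in>controls. z = \<rho> *\<^sub>R response t \<xi>)"
  unfolding attractor_def response_def by simp

lemma attractor_bound:
  assumes "0 \<le> \<rho>" "z \<in> attractor \<rho> \<Psi> t"
  shows "norm z \<le> \<rho> * (\<kappa> / \<gamma>)"
proof -
  obtain \<xi> where "\<xi> \<in> controls" "z = \<rho> *\<^sub>R response t \<xi>" using assms(2) mem_attractor_iff by blast
  then show ?thesis using norm_response[of \<xi> t] assms(1) mult_left_mono[of "norm (response t \<xi>)" "\<kappa> / \<gamma>" \<rho>] by simp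
qed

lemma attractor_nonempty: "attractor \<rho> \<Psi> t \<noteq> {}"
  using zero_control mem_attractor_iff by blast

lemma closed_attractor: "closed (attractor \<rho> \<Psi> t)"
proof -
  have "attractor \<rho> \<Psi> t = (*\<^sub>R) \<rho> ` (response t ` controls)"
    unfolding attractor_def response_def by auto
  then show ?thesis using closed_scaling[OF closed_responses] by simp
qed

lemma flow_set_attractor:
  assumes "t\<^sub>0 < t"
  shows "flow_set L \<rho> t t\<^sub>0 (attractor \<rho> \<Psi> t\<^sub>0) = attractor \<rho> \<Psi> t"
proof (intro equalityI subsetI)
  fix z assume "z \<in> flow_set L \<rho> t t\<^sub>0 (attractor \<rho> \<Psi> t\<^sub>0)"
  then obtain x where x: "x \<in> attractor \<rho> \<Psi> t\<^sub>0" "z \<in> flow L \<rho> t t\<^sub>0 x" unfolding flow_set_def by blast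
  obtain \<xi>\<^sub>1 where \<xi>1: "\<xi>\<^sub>1 \<in> controls" "x = \<rho> *\<^sub>R response t\<^sub>0 \<xi>\<^sub>1" using x(1) mem_attractor_iff by blast
  obtain \<xi>\<^sub>2 where \<xi>2: "\<xi>\<^sub>2 \<in> controls" "z = \<Psi> t t\<^sub>0 *v x + \<rho> *\<^sub>R reach t\<^sub>0 t \<xi>\<^sub>2"
    using x(2) mem_flow_iff[OF assms] by blast
  obtain \<xi> where \<xi>: "\<xi> \<in> controls" "response t\<^sub>0 \<xi> = response t\<^sub>0 \<xi>\<^sub>1" "reach t\<^sub>0 t \<xi> = reach t\<^sub>0 t \<xi>\<^sub>2"
    by (rule concatenate_controls[OF \<xi>1(1) \<xi>2(1)])
  have "z = \<rho> *\<^sub>R response t \<xi>"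
    using response_split[OF \<xi>(1) less_imp_le[OF assms]]
    by (simp add: \<xi>(2,3) \<xi>1(2) \<xi>2(2) matrix_vector_mult_scaleR scaleR_add_right)
  then show "z \<in> attractor \<rho> \<Psi> t" using \<xi>(1) mem_attractor_iff by blast
next
  fix z assume "z \<in> attractor \<rho> \<Psi> t"
  then obtain \<xi> where \<xi>: "\<xi> \<in> controls" "z = \<rho> *\<^sub>R response t \<xi>" using mem_attractor_iff by blast
  have "z = \<Psi> t t\<^sub>0 *v (\<rho> *\<^sub>R response t\<^sub>0 \<xi>) + \<rho> *\<^sub>R reach t\<^sub>0 t \<xi>"
    using response_split[OF \<xi>(1) less_imp_le[OF assms]]
    by (simp add: \<xi>(2) matrix_vector_mult_scaleR scaleR_add_right)
  then have "z \<in> flow L \<rho> t t\<^sub>0 (\<rho> *\<^sub>R response t\<^sub>0 \<xi>)"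
    using \<xi>(1) mem_flow_iff[OF assms] by blast
  moreover have "\<rho> *\<^sub>R response t\<^sub>0 \<xi> \<in> attractor \<rho> \<Psi> t\<^sub>0" using \<xi>(1) mem_attractor_iff by blast
  ultimately show "z \<in> flow_set L \<rho> t t\<^sub>0 (attractor \<rho> \<Psi> t\<^sub>0)" unfolding flow_set_def by blast
qed

lemma flow_contraction:
  assumes "t\<^sub>0 < t" "z \<in> flow L \<rho> t t\<^sub>0 x"
  obtains w where "w \<in> flow L \<rho> t t\<^sub>0 y" "dist z w \<le> \<kappa> * exp (- \<gamma> * (t - t\<^sub>0)) * dist x y"
proof -
  obtain \<xi> where \<xi>: "\<xi> \<in> controls" "z = \<Psi> t t\<^sub>0 *v x + \<rho> *\<^sub>R reach t\<^sub>0 t \<xi>"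
    using assms mem_flow_iff by blast
  define w where "w = \<Psi> t t\<^sub>0 *v y + \<rho> *\<^sub>R reach t\<^sub>0 t \<xi>"
  have "z - w = \<Psi> t t\<^sub>0 *v (x - y)" by (simp add: \<xi>(2) w_def matrix_vector_mult_diff_distrib)
  then have "dist z w \<le> \<kappa> * exp (- \<gamma> * (t - t\<^sub>0)) * dist x y"
    using norm_psi_vec[of t\<^sub>0 t "x - y"] assms(1) by (simp add: dist_norm)
  moreover have "w \<in> flow L \<rho> t t\<^sub>0 y" using \<xi>(1) mem_flow_iff[OF assms(1)] w_def by blast
  ultimately show ?thesis using that by blast
qed

lemma flow_nonempty: "t\<^sub>0 < t \<Longrightarrow> flow L \<rho> t t\<^sub>0 x \<noteq> {}"
  using zero_control mem_flow_iff by blast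

text \<open>Separates the two times, so that in either limit the other time enters only a constant
  factor.\<close>

lemma decay_factor: "\<kappa> * exp (- \<gamma> * (t - t\<^sub>0)) * C = \<kappa> * C * exp (- \<gamma> * t) * exp (\<gamma> * t\<^sub>0)"
  by (simp add: mult.assoc exp_add[symmetric]) (simp add: algebra_simps)

lemma decay_pullback: "((\<lambda>t\<^sub>0. \<kappa> * exp (- \<gamma> * (t - t\<^sub>0)) * C) \<longlongrightarrow> 0) at_bot"
proof -
  have "filterlim (\<lambda>t\<^sub>0. \<gamma> * t\<^sub>0) at_bot at_bot"
    by (rule filterlim_tendsto_pos_mult_at_bot[OF tendsto_const gamma filterlim_ident])
  then have "((\<lambda>t\<^sub>0. exp (\<gamma> * t\<^sub>0)) \<longlongrightarrow> 0) at_bot" by (rule filterlim_compose[OF exp_at_bot])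
  from tendsto_mult_right_zero[OF this] show ?thesis unfolding decay_factor .
qed

lemma decay_forward: "((\<lambda>t. \<kappa> * exp (- \<gamma> * (t - t\<^sub>0)) * C) \<longlongrightarrow> 0) at_top"
proof -
  have "filterlim (\<lambda>t. - \<gamma> * t) at_bot at_top"
    using gamma by (intro filterlim_tendsto_neg_mult_at_bot[OF tendsto_const] filterlim_ident) auto
  then have "((\<lambda>t. exp (- \<gamma> * t)) \<longlongrightarrow> 0) at_top" by (rule filterlim_compose[OF exp_at_bot])
  from tendsto_mult_left_zero[OF tendsto_mult_right_zero[OF this]] show ?thesis unfolding decay_factor .
qed

text \<open>A point of \<open>M t\<close> comes from some \<open>x\<close> in
  \<open>M t\<^sub>0\<close> for every earlier time; its control, started in
  \<open>N t\<^sub>0\<close> instead, ends in \<open>N t\<close>. The initial distance is at most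
  \<open>2 * C\<close> however early the start, so the endpoints become arbitrarily close, and
  \<open>N t\<close> is closed.\<close>

lemma bounded_invariant_subset:
  assumes M: "invariant_set L \<rho> M" "\<And>t x. x \<in> M t \<Longrightarrow> norm x \<le> C"
    and N: "invariant_set L \<rho> N" "\<And>t x. x \<in> N t \<Longrightarrow> norm x \<le> C"
  shows "M t \<subseteq> N t"
proof
  fix z assume z: "z \<in> M t"
  have "\<exists>w\<in>N t. dist w z < e" if "e > 0" for e
  proof -
    have "eventually (\<lambda>t\<^sub>0. \<kappa> * exp (- \<gamma> * (t - t\<^sub>0)) * (2 * C) < e \<and> t\<^sub>0 < t) at_bot"
      using order_tendstoD(2)[OF decay_pullback \<open>e > 0\<close>] by (intro eventually_conj eventually_gt_at_bot)
    then obtain t\<^sub>0 where t0: "\<kappa> * exp (- \<gamma> * (t - t\<^sub>0)) * (2 * C) < e" "t\<^sub>0 < t"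
      using eventually_happens'[OF trivial_limit_at_bot_linorder] by blast
    have "z \<in> flow_set L \<rho> t t\<^sub>0 (M t\<^sub>0)" using M(1) z t0(2) unfolding invariant_set_def by simp
    then obtain x where x: "x \<in> M t\<^sub>0" "z \<in> flow L \<rho> t t\<^sub>0 x" unfolding flow_set_def by blast
    obtain y where y: "y \<in> N t\<^sub>0" using N(1) unfolding invariant_set_def by blast
    obtain w where w: "w \<in> flow L \<rho> t t\<^sub>0 y" "dist z w \<le> \<kappa> * exp (- \<gamma> * (t - t\<^sub>0)) * dist x y"
      by (rule flow_contraction[OF t0(2) x(2)])
    have "w \<in> flow_set L \<rho> t t\<^sub>0 (N t\<^sub>0)" using w(1) y unfolding flow_set_def by blast
    then have "w \<in> N t" using N(1) t0(2) unfolding invariant_set_def by simp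
    have "dist x y \<le> 2 * C"
      using norm_triangle_ineq4[of x y] M(2)[OF x(1)] N(2)[OF y] by (simp add: dist_norm)
    then have "\<kappa> * exp (- \<gamma> * (t - t\<^sub>0)) * dist x y \<le> \<kappa> * exp (- \<gamma> * (t - t\<^sub>0)) * (2 * C)"
      using kappa by (intro mult_left_mono) auto
    then have "dist w z < e" using w(2) t0(1) by (simp add: dist_commute)
    then show ?thesis using \<open>w \<in> N t\<close> by blast
  qed
  then have "z \<in> closure (N t)" by (simp add: closure_approachable)
  moreover have "closed (N t)" using N(1) unfolding invariant_set_def by (simp add: compact_imp_closed)
  ultimately show "z \<in> N t" by simp
qed

lemma attractor_invariant:
  assumes "0 \<le> \<rho>"
  shows "invariant_set L \<rho> (attractor \<rho> \<Psi>)"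
proof -
  have "bounded (attractor \<rho> \<Psi> t)" for t
    using attractor_bound[OF assms] unfolding bounded_iff by blast
  then show ?thesis
    unfolding invariant_set_def
    using attractor_nonempty closed_attractor flow_set_attractor by (simp add: compact_eq_bounded_closed)
qed

lemma bounded_invariant_eq_attractor:
  assumes "0 \<le> \<rho>" "invariant_set L \<rho> M" "uniformly_bounded M"
  shows "M = attractor \<rho> \<Psi>"
proof -
  obtain y r where M: "\<And>t. M t \<subseteq> cball y r" using assms(3) unfolding uniformly_bounded_def by blast
  \<comment> \<open>One radius for both families, measured from the origin although the given ball
    is centred at \<open>y\<close>.\<close>
  define C where "C = max (norm y + r) (\<rho> * (\<kappa> / \<gamma>))"
  have MC: "norm x \<le> C" if "x \<in> M t" for x t
    using M[of t] that norm_triangle_sub[of x y] by (auto simp: C_def dist_norm norm_minus_commute)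
  have AC: "norm x \<le> C" if "x \<in> attractor \<rho> \<Psi> t" for x t
    using attractor_bound[OF assms(1) that] by (simp add: C_def)
  note A = attractor_invariant[OF assms(1)]
  have "M t = attractor \<rho> \<Psi> t" for t
  proof
    show "M t \<subseteq> attractor \<rho> \<Psi> t" by (rule bounded_invariant_subset[OF assms(2) _ A]) (rule MC AC, assumption)+
    show "attractor \<rho> \<Psi> t \<subseteq> M t" by (rule bounded_invariant_subset[OF A _ assms(2)]) (rule MC AC, assumption)+
  qed
  then show ?thesis by blast
qed

text \<open>The times enter the bound only through the exponential, so a single estimate serves both
  limits. The last factor bounds the distance from \<open>K\<close> to any point of the attractor at
  the initial time.\<close>

lemma semidist_flow_attractor:
  assumes "0 \<le> \<rho>" "K \<noteq> {}" "\<And>x. x \<in> K \<Longrightarrow> norm x \<le> C" "t\<^sub>0 < t"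
  shows "0 \<le> semidist (flow_set L \<rho> t t\<^sub>0 K) (attractor \<rho> \<Psi> t)"
    and "semidist (flow_set L \<rho> t t\<^sub>0 K) (attractor \<rho> \<Psi> t)
      \<le> ereal (\<kappa> * exp (- \<gamma> * (t - t\<^sub>0)) * (C + \<rho> * (\<kappa> / \<gamma>)))"
proof -
  show "0 \<le> semidist (flow_set L \<rho> t t\<^sub>0 K) (attractor \<rho> \<Psi> t)"
    by (rule semidist_nonneg) (use assms(2) flow_nonempty[OF assms(4)] in \<open>auto simp: flow_set_def\<close>)
  show "semidist (flow_set L \<rho> t t\<^sub>0 K) (attractor \<rho> \<Psi> t)
      \<le> ereal (\<kappa> * exp (- \<gamma> * (t - t\<^sub>0)) * (C + \<rho> * (\<kappa> / \<gamma>)))"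
  proof (rule semidist_le)
    fix z assume "z \<in> flow_set L \<rho> t t\<^sub>0 K"
    then obtain x where x: "x \<in> K" "z \<in> flow L \<rho> t t\<^sub>0 x" unfolding flow_set_def by blast
    obtain y where y: "y \<in> attractor \<rho> \<Psi> t\<^sub>0" using attractor_nonempty by blast
    obtain w where w: "w \<in> flow L \<rho> t t\<^sub>0 y" "dist z w \<le> \<kappa> * exp (- \<gamma> * (t - t\<^sub>0)) * dist x y"
      by (rule flow_contraction[OF assms(4) x(2)])
    have "w \<in> flow_set L \<rho> t t\<^sub>0 (attractor \<rho> \<Psi> t\<^sub>0)" using w(1) y unfolding flow_set_def by blast
    then have wA: "w \<in> attractor \<rho> \<Psi> t" by (simp add: flow_set_attractor[OF assms(4)])
    have "dist x y \<le> C + \<rho> * (\<kappa> / \<gamma>)"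
      using norm_triangle_ineq4[of x y] assms(3)[OF x(1)] attractor_bound[OF assms(1) y] by (simp add: dist_norm)
    then have "\<kappa> * exp (- \<gamma> * (t - t\<^sub>0)) * dist x y \<le> \<kappa> * exp (- \<gamma> * (t - t\<^sub>0)) * (C + \<rho> * (\<kappa> / \<gamma>))"
      using kappa by (intro mult_left_mono) auto
    then show "\<exists>y\<in>attractor \<rho> \<Psi> t. dist z y \<le> \<kappa> * exp (- \<gamma> * (t - t\<^sub>0)) * (C + \<rho> * (\<kappa> / \<gamma>))"
      using w(2) wA by (intro bexI[of _ w]) linarith+
  qed
qed

lemma pullback_attraction:
  assumes "0 \<le> \<rho>" "K \<noteq> {}" "compact K"
  shows "((\<lambda>t\<^sub>0. semidist (flow_set L \<rho> t t\<^sub>0 K) (attractor \<rho> \<Psi> t)) \<longlongrightarrow> 0) at_bot"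
proof -
  obtain C where C: "\<And>x. x \<in> K \<Longrightarrow> norm x \<le> C" using compact_imp_bounded[OF assms(3)] unfolding bounded_iff by blast
  note b = semidist_flow_attractor[OF assms(1,2) C]
  show ?thesis
  proof (rule tendsto_sandwich)
    show "\<forall>\<^sub>F t\<^sub>0 in at_bot. 0 \<le> semidist (flow_set L \<rho> t t\<^sub>0 K) (attractor \<rho> \<Psi> t)"
      \<comment> \<open>The estimates hold for \<open>t\<^sub>0 < t\<close> only, which is
        eventually the case.\<close>
      using eventually_gt_at_bot[of t] by eventually_elim (rule b(1))
    show "\<forall>\<^sub>F t\<^sub>0 in at_bot. semidist (flow_set L \<rho> t t\<^sub>0 K) (attractor \<rho> \<Psi> t)
        \<le> ereal (\<kappa> * exp (- \<gamma> * (t - t\<^sub>0)) * (C + \<rho> * (\<kappa> / \<gamma>)))"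
      using eventually_gt_at_bot[of t] by eventually_elim (rule b(2))
    show "((\<lambda>t\<^sub>0. ereal (\<kappa> * exp (- \<gamma> * (t - t\<^sub>0)) * (C + \<rho> * (\<kappa> / \<gamma>)))) \<longlongrightarrow> 0) at_bot"
      unfolding zero_ereal_def by (rule tendsto_ereal[OF decay_pullback])
  qed (rule tendsto_const)
qed

lemma forward_attraction:
  assumes "0 \<le> \<rho>" "K \<noteq> {}" "compact K"
  shows "((\<lambda>t. semidist (flow_set L \<rho> t t\<^sub>0 K) (attractor \<rho> \<Psi> t)) \<longlongrightarrow> 0) at_top"
proof -
  obtain C where C: "\<And>x. x \<in> K \<Longrightarrow> norm x \<le> C" using compact_imp_bounded[OF assms(3)] unfolding bounded_iff by blast
  note b = semidist_flow_attractor[OF assms(1,2) C]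
  show ?thesis
  proof (rule tendsto_sandwich)
    show "\<forall>\<^sub>F t in at_top. 0 \<le> semidist (flow_set L \<rho> t t\<^sub>0 K) (attractor \<rho> \<Psi> t)"
      using eventually_gt_at_top[of t\<^sub>0] by eventually_elim (rule b(1))
    show "\<forall>\<^sub>F t in at_top. semidist (flow_set L \<rho> t t\<^sub>0 K) (attractor \<rho> \<Psi> t)
        \<le> ereal (\<kappa> * exp (- \<gamma> * (t - t\<^sub>0)) * (C + \<rho> * (\<kappa> / \<gamma>)))"
      using eventually_gt_at_top[of t\<^sub>0] by eventually_elim (rule b(2))
    show "((\<lambda>t. ereal (\<kappa> * exp (- \<gamma> * (t - t\<^sub>0)) * (C + \<rho> * (\<kappa> / \<gamma>)))) \<longlongrightarrow> 0) at_top"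
      unfolding zero_ereal_def by (rule tendsto_ereal[OF decay_forward])
  qed (rule tendsto_const)
qed

end

theorem theorem4p2:
  fixes L :: "real \<Rightarrow> real^'n^'n" and \<rho> :: real and \<Psi> :: "real \<Rightarrow> real \<Rightarrow> real^'n^'n"
  assumes "CARD('n) \<ge> 2"
    and "\<rho> > 0"
    and "locally_integrable L"
    and "principal_matrix_solution L \<Psi>"
    and "exponentially_stable \<Psi>"
  shows "uniformly_bounded (attractor \<rho> \<Psi>) \<and>
    minimal_invariant_set L \<rho> (attractor \<rho> \<Psi>) \<and>
    (\<forall>M. uniformly_bounded M \<and> minimal_invariant_set L \<rho> M \<longrightarrow> M = attractor \<rho> \<Psi>) \<and>
    (\<forall>K. K \<noteq> {} \<and> compact K \<longrightarrow>
      (\<forall>t. ((\<lambda>t\<^sub>0. semidist (flow_set L \<rho> t t\<^sub>0 K) (attractor \<rho> \<Psi> t)) \<longlongrightarrow> 0) at_bot) \<and>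
      (\<forall>t\<^sub>0. ((\<lambda>t. semidist (flow_set L \<rho> t t\<^sub>0 K) (attractor \<rho> \<Psi> t)) \<longlongrightarrow> 0) at_top))"
proof -
  obtain \<kappa> \<gamma> where "\<kappa> \<ge> 1" "\<gamma> > 0"
    "\<And>t s. s \<le> t \<Longrightarrow> onorm ((*v) (\<Psi> t s)) \<le> \<kappa> * exp (- \<gamma> * (t - s))"
    using assms(5) unfolding exponentially_stable_def by blast
  then interpret stable_linear_system L \<Psi> \<kappa> \<gamma>
    using assms(3,4) by unfold_locales
  have \<rho>: "0 \<le> \<rho>" using assms(2) by simp
  have ub: "uniformly_bounded (attractor \<rho> \<Psi>)"
    unfolding uniformly_bounded_def using attractor_bound[OF \<rho>]
    by (intro exI[of _ 0] exI[of _ "\<rho> * (\<kappa> / \<gamma>)"]) auto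
  \<comment> \<open>Fibres inside the attractor inherit its bound, so minimality reduces to
    uniqueness among bounded invariant families.\<close>
  have "N = attractor \<rho> \<Psi>" if "\<forall>t. N t \<noteq> {} \<and> closed (N t) \<and> N t \<subseteq> attractor \<rho> \<Psi> t" "invariant_set L \<rho> N" for N
  proof (rule bounded_invariant_eq_attractor[OF \<rho> that(2)])
    show "uniformly_bounded N" using ub that(1) unfolding uniformly_bounded_def by (meson subset_trans)
  qed
  then have "minimal_invariant_set L \<rho> (attractor \<rho> \<Psi>)"
    unfolding minimal_invariant_set_def using attractor_invariant[OF \<rho>] by blast
  moreover have "M = attractor \<rho> \<Psi>" if "uniformly_bounded M" "minimal_invariant_set L \<rho> M" for M
    using bounded_invariant_eq_attractor[OF \<rho> _ that(1)] that(2) unfolding minimal_invariant_set_def by blast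
  ultimately show ?thesis using ub pullback_attraction[OF \<rho>] forward_attraction[OF \<rho>] by blast
qed

end
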